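(* Suppose that for every $q\in\mathcal{Q}$ the matrix $A_q$ is Hurwitz, and define $\mathcal{A}:=\{0\}\times\mathcal{Q}\times[0,N_0]$. Then there exists $\eta^*\in(0,\infty)$ such that for any $\eta\in(0,\eta^* )$ there exist constants $\kappa_1,\kappa_2,\kappa_3>0$ such that, for any continuous input $\tilde u:[0,\infty)\to\mathbb{R}^{|\mathcal{G}|+1}$ with $|\tilde u|_\infty:=\sup_{t\ge0}|\tilde u(t)|<\infty$, every maximal solution $\xi$ of the hybrid system $\mathcal{H}_{\tilde u}=(C,\tilde F,D,\tilde G)$ is complete and satisfies $$|\xi(t,j)|_{\mathcal{A}}\le\kappa_1\mathrm{e}^{-\kappa_2(t+j)}|\xi(0,0)|_{\mathcal{A}}+\kappa_3\big(|\tilde u|_\infty+c\big)\qquad\text{for all }(t,j)\in\mathrm{dom}(\xi),$$ where $$c:=\max_{q\in\mathcal{Q}}\max_{r\in\mathcal{Q}\setminus\{q\}}\big|A_r^{-1}b_r-A_q^{-1}b_q\big|.$$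
   Context: **Power-system data.** Let $\mathcal{G}$ be a finite nonempty set (generators), $n:=|\mathcal{G}|+2$, $m:=|\mathcal{G}|+1$, and let $\mathcal{Q}=\{1,\dots,l\}$, $l\ge2$, be a finite set of modes. For each $q\in\mathcal{Q}$ the matrices $A_q\in\mathbb{R}^{n\times n}$, $B_q\in\mathbb{R}^{n\times m}$ are $$A_q=\begin{bmatrix}-D_{\mathrm{net}}M_{\mathrm{eff}}^{-1}&M_{\mathrm{eff}}^{-1}\mathbf{1}^\top&0\\ A_\tau K&A_\tau&-A_\tau\zeta\\ \tau_z^{-1}\psi&\tau_z^{-1}\mathbf{1}^\top&-\tau_z^{-1}\end{bmatrix},\qquad B_q=\begin{bmatrix}-M_{\mathrm{eff}}^{-1}&\mathbf{0}^\top\\ \mathbf{0}&-A_\tau(I-\zeta\mathbf{1}^\top)\\ 0&\mathbf{0}^\top\end{bmatrix},$$ where the scalars $D_{\mathrm{net}}$ (net damping) and $M_{\mathrm{eff}}>0$ (effective inertia) may depend on $q$; $A_\tau=-\mathrm{diag}(\tau_1,\dots,\tau_{|\mathcal{G}|})^{-1}$ with turbine time constants $\tau_g>0$; $K\in\mathbb{R}^{|\mathcal{G}|}$ is the vector of governor gains; $\zeta\in[0,1]^{|\mathcal{G}|}$ with $\mathbf{1}^\top\zeta=1$; $\tau_z>\tau_g$ for all $g$; $\psi<0$ is the secondary-controller gain; $\mathbf{1}$, $\mathbf{0}$ are the all-ones and all-zeros vectors. For each $q$ a vector $u_q\in\mathbb{R}^m$ is given and $b_q:=B_qu_q$. A matrix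 is Hurwitz if all its eigenvalues have negative real part. **Hybrid system.** Fix $N_0\ge1$ (chatter bound). For $\eta\ge0$ and an input $\tilde u$, the hybrid system $\mathcal{H}_{\tilde u}=(C,\tilde F,D,\tilde G)$ has state $\xi=(y,q,\tau)$ and data $$C=\mathbb{R}^{n}\times\mathcal{Q}\times[0,N_0],\qquad D=\mathbb{R}^{n}\times\mathcal{Q}\times[1,N_0],$$ $$\tilde F(\xi,\tilde u)=\{A_qy+B_q\tilde u\}\times\{0\}\times[0,\eta],$$ $$\tilde G(\xi,\tilde u)=\bigcup_{r\in\mathcal{Q}\setminus\{q\}}\{y+A_r^{-1}b_r-A_q^{-1}b_q\}\times\{r\}\times\{\tau-1\}.$$ **Solutions.** A compact hybrid time domain is a set $\bigcup_{j=0}^{J-1}[t_j,t_{j+1}]\times\{j\}$ with $0=t_0\le t_1\le\dots\le t_J$; a hybrid time domain is a union of a non-decreasing sequence of compact ones. Given $\tilde u:[0,\infty)\to\mathbb{R}^m$, a solution is a function $\xi$ on a hybrid time domain $\mathrm{dom}(\xi)$ with $t\mapsto\xi(t,j)$ locally absolutely continuous on $I^j=\{t:(t,j)\in\mathrm{dom}(\xi)\}$ for each $j$, $\xi(0,0)\in\overline C\cup D$; whenever $I^j$ has nonempty interior, $\xi(t,j)\in C$ for all $t\in\mathrm{int}\,I^j$ and $\dot\xi(t,j)\in\tilde F(\xi(t,j),\tilde u(t))$ for almost all $t\in I^j$; whenever $(t,j),(t,j+1)\in\mathrm{dom}(\xi)$, $\xi(t,j)\in D$ and $\xi(t,j+1)\in\tilde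 G(\xi(t,j),\tilde u(t))$. A solution is maximal if it cannot be extended to a solution with a strictly larger domain, and complete if its domain is unbounded. $|\cdot|$ is the Euclidean norm and $|\xi|_{\mathcal{A}}=\inf_{z\in\mathcal{A}}|\xi-z|$. *)

theory Defs
  imports "HOL-Analysis.Analysis"
begin

definition complex_eigenvalue :: "real^'n^'n \<Rightarrow> complex \<Rightarrow> bool" where
  "complex_eigenvalue A z \<longleftrightarrow>
     (\<exists>v :: complex^'n. v \<noteq> 0 \<and> map_matrix complex_of_real A *v v = z *s v)"

definition hurwitz :: "real^'n^'n \<Rightarrow> bool" where
  "hurwitz A \<longleftrightarrow> (\<forall>z. complex_eigenvalue A z \<longrightarrow> Re z < 0)"

definition diag_matrix :: "real^'n \<Rightarrow> real^'n^'n" where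
  "diag_matrix d = (\<chi> i j. if i = j then d $ i else 0)"

text \<open>
  The members of \<open>\<D>\<close> are the compact intervals \<open>[Inf k, Sup k]\<close>, with pairwise disjoint interiors.
\<close>

definition abs_continuous_on :: "real set \<Rightarrow> (real \<Rightarrow> 'a::real_normed_vector) \<Rightarrow> bool" where
  "abs_continuous_on I f \<longleftrightarrow>
     (\<forall>\<epsilon>>0. \<exists>\<delta>>0. \<forall>\<D> S. \<D> division_of S \<longrightarrow> S \<subseteq> I \<longrightarrow>
        (\<Sum>k\<in>\<D>. Sup k - Inf k) < \<delta> \<longrightarrow> (\<Sum>k\<in>\<D>. norm (f (Sup k) - f (Inf k))) < \<epsilon>)"

definition loc_abs_continuous_on :: "real set \<Rightarrow> (real \<Rightarrow> 'a::real_normed_vector) \<Rightarrow> bool" where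
  "loc_abs_continuous_on I f \<longleftrightarrow> (\<forall>a b. {a..b} \<subseteq> I \<longrightarrow> abs_continuous_on {a..b} f)"

record ('s, 'u) hybrid_system =
  flow_set :: "'s set"
  flow_map :: "'s \<Rightarrow> 'u \<Rightarrow> 's set"
  jump_set :: "'s set"
  jump_map :: "'s \<Rightarrow> 'u \<Rightarrow> 's set"

text \<open>
  At least one interval is required, so that every hybrid time domain contains \<open>(0, 0)\<close>.
\<close>

definition compact_hybrid_time_domain :: "(real \<times> nat) set \<Rightarrow> bool" where
  "compact_hybrid_time_domain E \<longleftrightarrow>
     (\<exists>J (t :: nat \<Rightarrow> real). 1 \<le> J \<and> t 0 = 0 \<and> (\<forall>j<J. t j \<le> t (Suc j)) \<and>
        E = (\<Union>j<J. {t j..t (Suc j)} \<times> {j}))"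

definition hybrid_time_domain :: "(real \<times> nat) set \<Rightarrow> bool" where
  "hybrid_time_domain E \<longleftrightarrow>
     (\<exists>S :: nat \<Rightarrow> (real \<times> nat) set.
        (\<forall>k. compact_hybrid_time_domain (S k)) \<and> incseq S \<and> E = (\<Union>k. S k))"

definition flow_times :: "(real \<times> nat) set \<Rightarrow> nat \<Rightarrow> real set" where
  "flow_times E j = {t. (t, j) \<in> E}"

text \<open>
  A hybrid arc is a pair of its domain \<open>E\<close> and a total function \<open>\<xi>\<close>; the values of
  \<open>\<xi>\<close> outside \<open>E\<close> are irrelevant.
\<close>

definition hybrid_solution ::
  "('s::real_normed_vector, 'u) hybrid_system \<Rightarrow> (real \<Rightarrow> 'u) \<Rightarrow>
   (real \<times> nat) set \<Rightarrow> (real \<Rightarrow> nat \<Rightarrow> 's) \<Rightarrow> bool" where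
  "hybrid_solution H u E \<xi> \<longleftrightarrow>
     hybrid_time_domain E \<and>
     (\<forall>j. loc_abs_continuous_on (flow_times E j) (\<lambda>t. \<xi> t j)) \<and>
     \<xi> 0 0 \<in> closure (flow_set H) \<union> jump_set H \<and>
     (\<forall>j. interior (flow_times E j) \<noteq> {} \<longrightarrow>
        (\<forall>t \<in> interior (flow_times E j). \<xi> t j \<in> flow_set H) \<and>
        (AE t in lebesgue. t \<in> flow_times E j \<longrightarrow>
           (\<exists>v \<in> flow_map H (\<xi> t j) (u t).
              ((\<lambda>s. \<xi> s j) has_vector_derivative v) (at t within flow_times E j)))) \<and>
     (\<forall>t j. (t, j) \<in> E \<longrightarrow> (t, Suc j) \<in> E \<longrightarrow>
        \<xi> t j \<in> jump_set H \<and> \<xi> t (Suc j) \<in> jump_map H (\<xi> t j) (u t))"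

definition maximal_hybrid_solution ::
  "('s::real_normed_vector, 'u) hybrid_system \<Rightarrow> (real \<Rightarrow> 'u) \<Rightarrow>
   (real \<times> nat) set \<Rightarrow> (real \<Rightarrow> nat \<Rightarrow> 's) \<Rightarrow> bool" where
  "maximal_hybrid_solution H u E \<xi> \<longleftrightarrow>
     hybrid_solution H u E \<xi> \<and>
     \<not> (\<exists>E' \<xi>'. hybrid_solution H u E' \<xi>' \<and> E \<subset> E' \<and> (\<forall>(t, j) \<in> E. \<xi>' t j = \<xi> t j))"

definition complete_time_domain :: "(real \<times> nat) set \<Rightarrow> bool" where
  "complete_time_domain E \<longleftrightarrow>
     \<not> (\<exists>c. \<forall>(t, j) \<in> E. norm (t, real j) \<le> c)"

text \<open>
  The first state is the frequency, followed by the turbine states and the state of the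
  secondary controller; \<open>Load\<close> is the input that enters the frequency equation, followed by
  one input per generator.  Thus \<open>CARD('g state_ix) = CARD('g) + 2\<close> and
  \<open>CARD('g input_ix) = CARD('g) + 1\<close>.
\<close>

datatype 'g state_ix = Freq | Turb 'g | Sec

datatype 'g input_ix = Load | Gen 'g

instance state_ix :: (finite) finite
proof
  have "(UNIV :: 'a state_ix set) = {Freq, Sec} \<union> range Turb"
    by (auto intro: state_ix.exhaust)
  then show "finite (UNIV :: 'a state_ix set)"
    by (metis finite.emptyI finite.insertI finite_UnI finite_imageI finite_class.finite_UNIV)
qed

instance input_ix :: (finite) finite
proof
  have "(UNIV :: 'a input_ix set) = {Load} \<union> range Gen"
    by (auto intro: input_ix.exhaust)
  then show "finite (UNIV :: 'a input_ix set)"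
    by (metis finite.emptyI finite.insertI finite_UnI finite_imageI finite_class.finite_UNIV)
qed

definition turbine_matrix :: "real^'g::finite \<Rightarrow> real^'g^'g" where
  "turbine_matrix tau = - matrix_inv (diag_matrix tau)"

definition system_matrix ::
  "real \<Rightarrow> real \<Rightarrow> real^'g::finite \<Rightarrow> real^'g \<Rightarrow> real^'g \<Rightarrow> real \<Rightarrow> real
   \<Rightarrow> real^('g state_ix)^('g state_ix)" where
  "system_matrix Dnet Meff tau K zeta tauz psi =
     (\<chi> i j. case i of
        Freq \<Rightarrow> (case j of
            Freq \<Rightarrow> - Dnet * inverse Meff
          | Turb h \<Rightarrow> inverse Meff
          | Sec \<Rightarrow> 0)
      | Turb g \<Rightarrow> (case j of
            Freq \<Rightarrow> (turbine_matrix tau *v K) $ g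
          | Turb h \<Rightarrow> turbine_matrix tau $ g $ h
          | Sec \<Rightarrow> - (turbine_matrix tau *v zeta) $ g)
      | Sec \<Rightarrow> (case j of
            Freq \<Rightarrow> inverse tauz * psi
          | Turb h \<Rightarrow> inverse tauz
          | Sec \<Rightarrow> - inverse tauz))"

text \<open>The matrix \<open>(\<chi> g h. zeta $ g)\<close> is the outer product of \<open>zeta\<close> and the all-ones vector.\<close>

definition input_matrix ::
  "real \<Rightarrow> real^'g::finite \<Rightarrow> real^'g \<Rightarrow> real^('g input_ix)^('g state_ix)" where
  "input_matrix Meff tau zeta =
     (\<chi> i j. case i of
        Freq \<Rightarrow> (case j of Load \<Rightarrow> - inverse Meff | Gen h \<Rightarrow> 0)
      | Turb g \<Rightarrow> (case j of
            Load \<Rightarrow> 0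
          | Gen h \<Rightarrow> (- (turbine_matrix tau ** (mat 1 - (\<chi> g h. zeta $ g)))) $ g $ h)
      | Sec \<Rightarrow> 0)"

text \<open>
  The state is \<open>(y, p, s)\<close> with mode \<open>p = real q\<close>, \<open>q \<in> {1..l}\<close>, and timer \<open>s\<close>.  Modes are
  embedded in the reals so that the norm on the product type is the Euclidean norm of the
  full hybrid state.
\<close>

type_synonym 'n switched_state = "(real^'n) \<times> real \<times> real"

definition switched_system ::
  "nat \<Rightarrow> (nat \<Rightarrow> real^'n^'n) \<Rightarrow> (nat \<Rightarrow> real^'m^'n) \<Rightarrow> (nat \<Rightarrow> real^'n) \<Rightarrow> real \<Rightarrow> real
   \<Rightarrow> ('n switched_state, real^'m) hybrid_system" where
  "switched_system l A B b N0 \<eta> =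
     \<lparr> flow_set = UNIV \<times> real ` {1..l} \<times> {0..N0},
       flow_map = (\<lambda>(y, p, s) v.
         \<Union>q\<in>{q \<in> {1..l}. p = real q}. {A q *v y + B q *v v} \<times> {0} \<times> {0..\<eta>}),
       jump_set = UNIV \<times> real ` {1..l} \<times> {1..N0},
       jump_map = (\<lambda>(y, p, s) v.
         \<Union>q\<in>{q \<in> {1..l}. p = real q}. \<Union>r\<in>{1..l} - {q}.
           {y + matrix_inv (A r) *v b r - matrix_inv (A q) *v b q} \<times> {real r} \<times> {s - 1}) \<rparr>"

definition attractor :: "nat \<Rightarrow> real \<Rightarrow> ('n::finite) switched_state set" where
  "attractor l N0 = {0} \<times> real ` {1..l} \<times> {0..N0}"

end

theory Submission
  imports Defs "HOL-Computational_Algebra.Fundamental_Theorem_Algebra"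
begin

text \<open>
  A Hurwitz matrix \<open>A\<close> has a quadratic Lyapunov form: a product of factors \<open>A - z I\<close> over
  eigenvalues \<open>z\<close> vanishes, so applying the factors successively to \<open>y\<close> gives a finite chain
  \<open>y\<^sub>0 = y\<close>, \<open>A y\<^sub>k = z\<^sub>k y\<^sub>k + y\<^sub>k\<^sub>+\<^sub>1\<close> ending in \<open>0\<close>, and
  \<open>\<Sum>k. w ^ k * (norm y\<^sub>k)\<^sup>2\<close> is dissipated once the weight \<open>w\<close> is large enough.
  Let \<open>P\<^sub>q\<close> be such a form for mode \<open>q\<close>, all of them bounded by \<open>K\<close>, and \<open>L = ln (4 K)\<close>.  The function
  \<open>exp (L s) P\<^sub>q(y, y)\<close> of the hybrid state contracts along flows, because the timer \<open>s\<close> grows at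
  rate at most \<open>\<eta>\<close> with \<open>L \<eta>\<close> below the dissipation rate, and at jumps, because the decrease of \<open>s\<close>
  by \<open>1\<close> outweighs the change of the form.  So it decays exponentially in \<open>t + j\<close> up to an offset
  given by the input and the jump displacements.  A solution is therefore bounded, hence Lipschitz
  along flows; if its time domain were bounded, it would have a limit at the final time and could
  be continued from there by flowing with the timer frozen.
\<close>

section \<open>Quadratic Lyapunov functions of Hurwitz matrices\<close>

text \<open>The quadratic form comes from a finite list of eigenvalues by algebra alone, without a
  Jordan basis or a matrix exponential; all that matters is that every listed eigenvalue has real
  part at most some \<open>- a\<close>. Forms of different modes are comparable only up to the
  factor \<open>K\<close>, so a switch may raise the energy, and no estimate of the form alone would
  survive arbitrarily many switches. The timer acts as a budget for them: the weight
  \<open>exp (L * s)\<close> stays between 1 and \<open>exp (L * N0)\<close>, so over a whole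
  solution it costs only a constant, although it pays for every single jump. Its growth during flow
  is what limits \<open>\<eta>\<close> to values below \<open>a / ln (4 * K)\<close>. Solutions are
  merely absolutely continuous, in the epsilon-delta sense. Instead of integrating velocities, the
  proof rests on one monotonicity theorem for functions with nonpositive derivative almost
  everywhere; the decay along flows, the constancy of the mode and the Lipschitz bound are all
  derived from it.\<close>

fun shifted_product :: "complex^'n^'n \<Rightarrow> complex list \<Rightarrow> complex^'n \<Rightarrow> complex^'n" where
  "shifted_product M [] x = x"
| "shifted_product M (z # zs) x = shifted_product M zs (M *v x - z *s x)"

text \<open>All factors are polynomials in \<open>M\<close>, so one more factor may be applied
  before or after the product. This makes the position of a factor in the list irrelevant.\<close>

lemma shifted_product_commute:
  fixes M :: "complex^'n^'n"
  shows "shifted_product M zs (M *v x - z *s x) = M *v shifted_product M zs x - z *s shifted_product M zs x"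
proof (induction zs arbitrary: x)
  case (Cons a zs)
  have "M *v (M *v x - z *s x) - a *s (M *v x - z *s x)
      = M *v (M *v x - a *s x) - z *s (M *v x - a *s x)"
    by (simp add: matrix_vector_mult_diff_distrib vector_scalar_commute vector_ssub_ldistrib
        vector_smult_assoc algebra_simps)
  then show ?case using Cons[of "M *v x - a *s x"] by (simp only: shifted_product.simps)
qed simp

text \<open>If \<open>z\<close> is not an eigenvalue, the factor \<open>M - z I\<close> is injective
  and can be cancelled from a vanishing product. The cancellation is needed because an arbitrary
  annihilating polynomial may have roots outside the spectrum.\<close>

lemma shifted_product_filter_eigenvalues:
  fixes M :: "complex^'n^'n"
  assumes "\<And>x. shifted_product M zs x = 0"
  defines "eig \<equiv> (\<lambda>z. \<exists>v. v \<noteq> 0 \<and> M *v v = z *s v)"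
  shows "shifted_product M (filter eig zs) x = 0"
proof -
  have "shifted_product M zs x = 0 \<Longrightarrow> shifted_product M (filter eig zs) x = 0" for x
  proof (induction zs arbitrary: x)
    case (Cons z zs)
    then have *: "shifted_product M (filter eig zs) (M *v x - z *s x) = 0" by simp
    show ?case
    proof (cases "eig z")
      case False
      then show ?thesis
        using * by (auto simp: shifted_product_commute eig_def)
    qed (use * in simp)
  qed simp
  with assms show ?thesis by blast
qed

section \<open>Annihilating polynomials and their factorization\<close>

definition poly_apply :: "complex^'n^'n \<Rightarrow> nat \<Rightarrow> complex poly \<Rightarrow> complex^'n \<Rightarrow> complex^'n" where
  "poly_apply M N p x = (\<Sum>k\<le>N. coeff p k *s (((*v) M) ^^ k) x)"

lemma funpow_shift:
  fixes M :: "complex^'n^'n"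
  shows "(((*v) M) ^^ k) (M *v x - a *s x) = (((*v) M) ^^ Suc k) x - a *s (((*v) M) ^^ k) x"
proof (induction k)
  case (Suc k)
  then show ?case
    by (simp add: matrix_vector_mult_diff_distrib vector_scalar_commute)
qed simp

text \<open>Coefficient \<open>k\<close> of the product is coefficient \<open>k - 1\<close> of
  \<open>q\<close> minus \<open>a\<close> times coefficient \<open>k\<close>; shifting the index
  moves one power of \<open>M\<close> onto \<open>x\<close>. The summation bound \<open>N\<close> is
  only required to dominate the degree, so the exact degree of a product never has to be
  computed.\<close>

lemma poly_apply_linear_factor:
  fixes M :: "complex^'n^'n"
  assumes "degree q \<le> N"
  shows "poly_apply M (Suc N) ([:-a, 1:] * q) x = poly_apply M N q (M *v x - a *s x)"
proof -
  let ?T = "\<lambda>k. (((*v) M) ^^ k) x"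
  have c: "coeff ([:-a, 1:] * q) k *s ?T k = (case k of 0 \<Rightarrow> 0 | Suc j \<Rightarrow> coeff q j *s ?T k) - (a * coeff q k) *s ?T k" for k
    by (cases k) (simp_all add: vec_eq_iff algebra_simps del: funpow.simps)
  have z: "coeff q (Suc N) = 0" using assms by (simp add: coeff_eq_0)
  have "poly_apply M (Suc N) ([:-a, 1:] * q) x
      = (\<Sum>k\<le>Suc N. case k of 0 \<Rightarrow> 0 | Suc j \<Rightarrow> coeff q j *s ?T k) - (\<Sum>k\<le>Suc N. (a * coeff q k) *s ?T k)"
    unfolding poly_apply_def c sum_subtractf ..
  also have "(\<Sum>k\<le>Suc N. case k of 0 \<Rightarrow> 0 | Suc j \<Rightarrow> coeff q j *s ?T k) = (\<Sum>k\<le>N. coeff q k *s ?T (Suc k))"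
    by (subst sum.atMost_Suc_shift) simp
  also have "(\<Sum>k\<le>Suc N. (a * coeff q k) *s ?T k) = (\<Sum>k\<le>N. (a * coeff q k) *s ?T k)"
    using z by simp
  finally show ?thesis
    unfolding poly_apply_def funpow_shift sum_subtractf[symmetric]
    by (simp add: vector_ssub_ldistrib vector_smult_assoc mult.commute)
qed

text \<open>The degree bound is carried along because the induction step needs it to apply
  \<open>poly_apply_linear_factor\<close>.\<close>

lemma poly_apply_prod_list:
  fixes M :: "complex^'n^'n"
  shows "degree (\<Prod>z\<leftarrow>zs. [:-z, 1:]) \<le> length zs \<and>
    poly_apply M (length zs) (\<Prod>z\<leftarrow>zs. [:-z, 1:]) x = shifted_product M zs x"
proof (induction zs arbitrary: x)
  case Nil
  show ?case by (simp add: poly_apply_def)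
next
  case (Cons z zs)
  have "degree ([:-z, 1:] * (\<Prod>z\<leftarrow>zs. [:-z, 1:])) \<le> Suc (length zs)"
    using degree_mult_le[of "[:-z, 1:]" "(\<Prod>z\<leftarrow>zs. [:-z, 1:])"] Cons by (auto intro: order_trans)
  then show ?case
    using Cons poly_apply_linear_factor[of "(\<Prod>z\<leftarrow>zs. [:-z, 1:])" "length zs" M z x]
    by (simp del: mult_pCons_left)
qed

text \<open>A dimension count is enough, since nothing depends on the degree: the powers of
  \<open>M\<close> up to the real dimension of the matrix space are one too many to be linearly
  independent.\<close>

lemma exists_annihilating_polynomial:
  fixes M :: "complex^'n^'n"
  obtains p where "p \<noteq> 0" "\<And>x. poly_apply M (degree p) p x = 0"
proof -
  define mp where "mp k = (((**) M) ^^ k) (mat 1)" for k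
  define N where "N = DIM(complex^'n^'n)"
  have mp: "mp k *v x = (((*v) M) ^^ k) x" for k x
    unfolding mp_def by (induction k) (auto simp: matrix_vector_mul_assoc[symmetric])
  \<comment> \<open>Linear dependence is a property of sets, so coinciding powers are a separate
    case; there the relation is the difference of two equal powers.\<close>
  obtain c where c: "(\<Sum>k\<le>N. c k *\<^sub>R mp k) = 0" "\<exists>k\<le>N. c k \<noteq> (0::real)"
  proof (cases "inj_on mp {..N}")
    case True
    then have "dependent (mp ` {..N})"
      by (intro dependent_biggerset) (auto simp: card_image N_def)
    then obtain u where u: "\<exists>v\<in>mp ` {..N}. u v \<noteq> 0" "(\<Sum>v\<in>mp ` {..N}. u v *\<^sub>R v) = 0"
      by (subst (asm) dependent_finite) auto
    show ?thesis
      by (rule that[of "u \<circ> mp"]) (use u True in \<open>auto simp: sum.reindex\<close>)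
  next
    case False
    then obtain i j where ij: "i \<le> N" "j \<le> N" "i \<noteq> j" "mp i = mp j"
      by (auto simp: inj_on_def)
    let ?c = "\<lambda>k. if k = i then 1 else if k = j then -1 else (0::real)"
    have "(\<Sum>k\<le>N. ?c k *\<^sub>R mp k) = (\<Sum>k\<in>{i,j}. ?c k *\<^sub>R mp k)"
      by (rule sum.mono_neutral_right) (use ij in auto)
    also have "\<dots> = 0" using ij by simp
    finally show ?thesis
      by (intro that[of ?c]) (use ij in auto)
  qed
  define p where "p = (\<Sum>k\<le>N. monom (complex_of_real (c k)) k)"
  have cp: "coeff p k = (if k \<le> N then complex_of_real (c k) else 0)" for k
    unfolding p_def by (simp add: coeff_sum)
  have p0: "p \<noteq> 0"
    using c(2) cp by (metis coeff_0 of_real_eq_0_iff)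
  have dN: "degree p \<le> N"
    by (rule degree_le) (simp add: cp)
  show ?thesis
  proof (rule that[OF p0])
    fix x
    have "poly_apply M (degree p) p x = poly_apply M N p x"
      unfolding poly_apply_def
      by (rule sum.mono_neutral_left) (use dN in \<open>auto simp: coeff_eq_0\<close>)
    also have "\<dots> = (\<Sum>k\<le>N. (c k *\<^sub>R mp k) *v x)"
      unfolding poly_apply_def mp[symmetric]
      by (intro sum.cong) (auto simp: cp vec_eq_iff matrix_vector_mult_def sum_distrib_left scaleR_conv_of_real[where 'a=complex] mult.assoc)
    also have "\<dots> = (\<Sum>k\<le>N. c k *\<^sub>R mp k) *v x"
      by (simp add: vec_eq_iff matrix_vector_mult_def sum_distrib_right)
         (subst sum.swap, simp)
    finally show "poly_apply M (degree p) p x = 0"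
      using c by simp
  qed
qed

text \<open>Over the complex numbers the annihilating polynomial splits into linear factors. Its
  nonzero leading coefficient can be divided out, and the factors belonging to no eigenvalue are
  then discarded.\<close>

lemma exists_annihilating_eigenvalues:
  fixes M :: "complex^'n^'n"
  obtains zs where "\<And>x. shifted_product M zs x = 0"
    "\<And>z. z \<in> set zs \<Longrightarrow> \<exists>v. v \<noteq> 0 \<and> M *v v = z *s v"
proof -
  obtain p where p: "p \<noteq> 0" "\<And>x. poly_apply M (degree p) p x = 0"
    using exists_annihilating_polynomial[of M] by blast
  obtain R where R: "size R = degree p" "p = smult (lead_coeff p) (\<Prod>x\<in>#R. [:-x, 1:])"
    using alg_closed_imp_factorization[OF p(1)] by blast
  obtain zs where zs: "mset zs = R" using ex_mset by blast
  have pr: "(\<Prod>x\<in>#R. [:-x, 1:]) = (\<Prod>z\<leftarrow>zs. [:-z, 1:])"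
    unfolding zs[symmetric] mset_map[symmetric] prod_mset_prod_list ..
  have l: "length zs = degree p" using zs R by auto
  have "shifted_product M zs x = 0" for x
  proof -
    have "poly_apply M (degree p) p x = lead_coeff p *s poly_apply M (length zs) (\<Prod>z\<leftarrow>zs. [:-z, 1:]) x"
      unfolding poly_apply_def l
      by (subst R(2)) (simp add: pr vec_eq_iff sum_distrib_left mult.assoc)
    then show ?thesis
      using p poly_apply_prod_list[of zs M x] by simp
  qed
  from that[OF shifted_product_filter_eigenvalues[OF this]] show ?thesis by auto
qed

section \<open>The weighted quadratic form along the chain\<close>

fun chain_form :: "real \<Rightarrow> complex^'n^'n \<Rightarrow> complex list \<Rightarrow> complex^'n \<Rightarrow> complex^'n \<Rightarrow> real" where
  "chain_form w M [] x y = 0"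
| "chain_form w M (z # zs) x y =
     inner x y + w * chain_form w M zs (M *v x - z *s x) (M *v y - z *s y)"

lemma bounded_linear_shift:
  fixes M :: "complex^'n^'n"
  shows "bounded_linear (\<lambda>x. M *v x - z *s x)"
  unfolding linear_conv_bounded_linear[symmetric]
  by (intro linearI)
    (auto simp: matrix_vector_right_distrib vector_add_ldistrib vec_eq_iff matrix_vector_mult_def
      algebra_simps scaleR_sum_right sum.distrib)

text \<open>The form is kept bilinear, not merely quadratic, because its derivative along a flow
  pairs the state with its velocity. This property later supplies the product rule, the absolute
  continuity along solutions and the upper bound \<open>K\<close>.\<close>

lemma bounded_bilinear_chain_form:
  fixes M :: "complex^'n^'n"
  shows "bounded_bilinear (chain_form w M zs)"
proof (induction zs)
  case Nil
  show ?case unfolding chain_form.simps by unfold_locales (simp_all, rule exI[of _ 0], simp)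
next
  case (Cons z zs)
  have 1: "bounded_bilinear (\<lambda>x y. chain_form w M zs (M *v x - z *s x) (M *v y - z *s y))"
    by (rule bounded_bilinear.comp[OF Cons bounded_linear_shift bounded_linear_shift])
  interpret C: bounded_bilinear "\<lambda>x y. chain_form w M zs (M *v x - z *s x) (M *v y - z *s y)" by fact
  obtain K where K: "\<And>x y. norm (chain_form w M zs (M *v x - z *s x) (M *v y - z *s y)) \<le> norm x * norm y * K"
    using C.bounded by blast
  show ?case
  proof
    show "\<exists>K. \<forall>x y. norm (chain_form w M (z # zs) x y) \<le> norm x * norm y * K"
    proof (intro exI[of _ "1 + \<bar>w\<bar> * K"] allI)
      fix x y
      have "norm (chain_form w M (z # zs) x y)
          \<le> \<bar>inner x y\<bar> + \<bar>w\<bar> * norm (chain_form w M zs (M *v x - z *s x) (M *v y - z *s y))"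
        by (simp add: abs_mult[symmetric])
      also have "\<dots> \<le> norm x * norm y + \<bar>w\<bar> * (norm x * norm y * K)"
        by (intro add_mono Cauchy_Schwarz_ineq2 mult_left_mono K) auto
      finally show "norm (chain_form w M (z # zs) x y) \<le> norm x * norm y * (1 + \<bar>w\<bar> * K)"
        by (simp add: algebra_simps)
    qed
  qed (simp_all only: chain_form.simps C.add_left C.add_right C.scaleR_left C.scaleR_right
      inner_add_left inner_add_right inner_scaleR_left inner_scaleR_right, simp_all add: algebra_simps)
qed

lemma chain_form_commute: "chain_form w M zs x y = chain_form w M zs y x"
  by (induction zs arbitrary: x y) (auto simp: inner_commute)

text \<open>Write \<open>M *v x = z *s x + d\<close> with \<open>d\<close> the next link. The first
  summand contributes at most \<open>- a * (norm x)^2\<close>, and Young's inequality bounds the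
  cross term by \<open>a / 2 * (norm x)^2 + (norm d)^2 / (2 * a)\<close>. The last term is paid by
  the next link: its surplus \<open>(a/4) * (norm d)^2\<close>, multiplied by
  \<open>w = 2 / a^2\<close>, is exactly \<open>(norm d)^2 / (2 * a)\<close>. This is why the
  statement carries a surplus in \<open>norm x\<close> and where \<open>w\<close> comes
  from.\<close>

lemma chain_form_dissipative:
  fixes M :: "complex^'n^'n"
  assumes a: "a > 0" and w: "w = 2 / a\<^sup>2"
    and "\<And>z. z \<in> set zs \<Longrightarrow> Re z \<le> - a" "shifted_product M zs x = 0"
  shows "chain_form w M zs x (M *v x) \<le> - (a/4) * chain_form w M zs x x - (a/4) * (norm x)\<^sup>2"
  using assms(3,4)
proof (induction zs arbitrary: x)
  case (Cons z zs)
  define d where "d = M *v x - z *s x"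
  have Mx: "M *v x = z *s x + d" by (simp add: d_def)
  \<comment> \<open>The chain of \<open>M *v x\<close> is \<open>M\<close> applied to the chain of
    \<open>x\<close>, so the induction hypothesis applies to the tail.\<close>
  have dd: "M *v (M *v x) - z *s (M *v x) = M *v d"
    unfolding d_def by (simp add: matrix_vector_mult_diff_distrib vector_scalar_commute)
  have IH: "chain_form w M zs d (M *v d) \<le> - (a/4) * chain_form w M zs d d - (a/4) * (norm d)\<^sup>2"
    using Cons by (auto simp: d_def)
  have "inner x (z *s x) = Re z * (norm x)\<^sup>2"
    unfolding inner_vec_def norm_vec_def L2_set_def
    by (simp add: inner_complex_def sum_nonneg sum_distrib_left cmod_power2)
       (simp add: power2_eq_square algebra_simps)
  also have "\<dots> \<le> - a * (norm x)\<^sup>2"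
    using Cons.prems(1)[of z] by (intro mult_right_mono) auto
  finally have 1: "inner x (z *s x) \<le> - a * (norm x)\<^sup>2" .
  have 2: "inner x d \<le> norm x * norm d" by (rule norm_cauchy_schwarz)
  have "0 \<le> (a * norm x - norm d)\<^sup>2" by simp
  then have "norm x * norm d * (2 * a) \<le> a\<^sup>2 * (norm x)\<^sup>2 + (norm d)\<^sup>2"
    by (simp add: power2_eq_square algebra_simps)
  then have 3: "norm x * norm d \<le> a / 2 * (norm x)\<^sup>2 + (norm d)\<^sup>2 / (2 * a)"
    using a by (simp add: field_simps power2_eq_square)
  have w0: "0 \<le> w" using w by simp
  have "w * chain_form w M zs d (M *v d) \<le> w * (- (a/4) * chain_form w M zs d d - (a/4) * (norm d)\<^sup>2)"
    using IH w0 by (rule mult_left_mono)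
  also have "\<dots> = - (a/4) * (w * chain_form w M zs d d) - (norm d)\<^sup>2 / (2 * a)"
    using a unfolding w by (simp add: field_simps power2_eq_square)
  finally have 4: "w * chain_form w M zs d (M *v d) \<le> - (a/4) * (w * chain_form w M zs d d) - (norm d)\<^sup>2 / (2 * a)" .
  have "chain_form w M (z # zs) x (M *v x) = inner x (z *s x) + inner x d + w * chain_form w M zs d (M *v d)"
    by (simp only: chain_form.simps dd d_def[symmetric]) (simp only: Mx inner_add_right)
  also have "\<dots> \<le> - (a/2) * (norm x)\<^sup>2 - (a/4) * (w * chain_form w M zs d d)"
    using 1 2 3 4 by (simp add: algebra_simps)
  also have "\<dots> = - (a/4) * chain_form w M (z # zs) x x - (a/4) * (norm x)\<^sup>2"
    by (simp only: chain_form.simps d_def[symmetric] power2_norm_eq_inner) (simp add: algebra_simps)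
  finally show ?case .
qed simp

lemma chain_form_nonneg: "0 \<le> w \<Longrightarrow> 0 \<le> chain_form w M zs x x"
  by (induction zs arbitrary: x) auto

text \<open>The first link is \<open>x\<close> itself with weight 1, and the remaining terms are
  nonnegative. For the empty list the vanishing hypothesis says \<open>x = 0\<close>.\<close>

lemma chain_form_ge_norm:
  assumes "0 \<le> w" "shifted_product M zs x = 0"
  shows "(norm x)\<^sup>2 \<le> chain_form w M zs x x"
  using assms by (cases zs) (auto simp: chain_form_nonneg power2_norm_eq_inner)

section \<open>Pulling the form back to real vectors\<close>

definition complexify :: "real^'n \<Rightarrow> complex^'n" where
  "complexify x = (\<chi> i. complex_of_real (x $ i))"

lemma norm_complexify: "norm (complexify x) = norm x"
  by (simp add: complexify_def norm_vec_def)

lemma bounded_linear_complexify: "bounded_linear complexify"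
  unfolding linear_conv_bounded_linear[symmetric]
  by (intro linearI) (auto simp: complexify_def vec_eq_iff scaleR_conv_of_real[where 'a=complex])

lemma complexify_mult: "map_matrix complex_of_real A *v complexify x = complexify (A *v x)"
  by (simp add: complexify_def vec_eq_iff matrix_vector_mult_def map_matrix_def)

text \<open>\<open>complexify\<close> is isometric and intertwines \<open>A\<close> with its
  complexification, so both estimates of the chain form pull back. The finite list of eigenvalues
  turns strict negativity of real parts into a uniform gap.\<close>

lemma hurwitz_quadratic_form:
  fixes A :: "real^'n^'n"
  assumes "hurwitz A"
  obtains P a where "bounded_bilinear P" "\<And>x y. P x y = P y x" "a > 0"
    "\<And>x. (norm x)\<^sup>2 \<le> P x x" "\<And>x. P x (A *v x) \<le> - a * P x x"
proof -
  define M where "M = map_matrix complex_of_real A"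
  obtain zs where zs: "\<And>x. shifted_product M zs x = 0"
    "\<And>z. z \<in> set zs \<Longrightarrow> \<exists>v. v \<noteq> 0 \<and> M *v v = z *s v"
    using exists_annihilating_eigenvalues[of M] by blast
  have neg: "Re z < 0" if "z \<in> set zs" for z
    using assms zs(2)[OF that] unfolding hurwitz_def complex_eigenvalue_def M_def by blast
  obtain a where a: "a > 0" "\<And>z. z \<in> set zs \<Longrightarrow> Re z \<le> - a"
  proof
    \<comment> \<open>The inserted 1 makes the set visibly nonempty and keeps the minimum
      positive.\<close>
    let ?a = "Min (insert 1 ((\<lambda>z. - Re z) ` set zs))"
    show "?a > 0" using neg by (subst Min_gr_iff) auto
    show "Re z \<le> - ?a" if "z \<in> set zs" for z
    proof -
      have "?a \<le> - Re z" using that by (intro Min_le) auto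
      then show ?thesis by linarith
    qed
  qed
  define w where "w = 2 / a\<^sup>2"
  have w0: "0 \<le> w" by (simp add: w_def)
  define P where "P x y = chain_form w M zs (complexify x) (complexify y)" for x y
  have "bounded_bilinear P"
    unfolding P_def
    by (rule bounded_bilinear.comp[OF bounded_bilinear_chain_form bounded_linear_complexify bounded_linear_complexify])
  moreover have "P x y = P y x" for x y
    unfolding P_def by (rule chain_form_commute)
  moreover have "(norm x)\<^sup>2 \<le> P x x" for x
    using chain_form_ge_norm[OF w0 zs(1), of "complexify x"] by (simp add: P_def norm_complexify)
  moreover have "P x (A *v x) \<le> - (a/4) * P x x" for x
  proof -
    have "P x (A *v x) = chain_form w M zs (complexify x) (M *v complexify x)"
      unfolding P_def M_def complexify_mult ..
    also have "\<dots> \<le> - (a/4) * P x x - (a/4) * (norm (complexify x))\<^sup>2"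
      unfolding P_def by (rule chain_form_dissipative[OF a(1) w_def a(2) zs(1)])
    also have "\<dots> \<le> - (a/4) * P x x" using a(1) by simp
    finally show ?thesis .
  qed
  ultimately show ?thesis using a(1) by (intro that[of P "a/4"]) auto
qed

section \<open>Absolutely continuous functions\<close>

lemma abs_continuous_onD:
  assumes "abs_continuous_on I f" "e > 0"
  obtains d where "d > 0"
    "\<And>\<D> S. \<D> division_of S \<Longrightarrow> S \<subseteq> I \<Longrightarrow> (\<Sum>k\<in>\<D>. Sup k - Inf k) < d \<Longrightarrow>
      (\<Sum>k\<in>\<D>. norm (f (Sup k) - f (Inf k))) < e"
  using assms unfolding abs_continuous_on_def by metis

lemma division_of_real_member:
  fixes S :: "real set"
  assumes "\<D> division_of S" "k \<in> \<D>"
  shows "k = {Inf k..Sup k}" "Inf k \<le> Sup k" "Inf k \<in> S" "Sup k \<in> S"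
proof -
  obtain a b where ab: "k = cbox a b" using assms division_ofD(4) by blast
  moreover have "k \<noteq> {}" "k \<subseteq> S" using assms division_ofD(2,3) by blast+
  ultimately show "k = {Inf k..Sup k}" "Inf k \<le> Sup k" "Inf k \<in> S" "Sup k \<in> S"
    by auto
qed

lemma abs_continuous_on_subset: "abs_continuous_on I f \<Longrightarrow> J \<subseteq> I \<Longrightarrow> abs_continuous_on J f"
  unfolding abs_continuous_on_def by (meson order_trans)

lemma abs_continuous_on_compose_lipschitz:
  assumes f: "abs_continuous_on I f"
    and g: "\<And>s t. s \<in> I \<Longrightarrow> t \<in> I \<Longrightarrow> norm (g (f s) - g (f t)) \<le> M * norm (f s - f t)"
  shows "abs_continuous_on I (\<lambda>t. g (f t))"
  unfolding abs_continuous_on_def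
proof (intro allI impI)
  fix e :: real assume e: "e > 0"
  \<comment> \<open>\<open>M\<close> may be zero or negative; \<open>M'\<close> can be divided
    by.\<close>
  define M' where "M' = max 1 M"
  have M': "M' > 0" "M \<le> M'" by (auto simp: M'_def)
  obtain d where d: "d > 0"
    "\<And>\<D> S. \<D> division_of S \<Longrightarrow> S \<subseteq> I \<Longrightarrow> (\<Sum>k\<in>\<D>. Sup k - Inf k) < d \<Longrightarrow>
      (\<Sum>k\<in>\<D>. norm (f (Sup k) - f (Inf k))) < e / M'"
    using abs_continuous_onD[OF f, of "e / M'"] e M' by auto
  show "\<exists>\<delta>>0. \<forall>\<D> S. \<D> division_of S \<longrightarrow> S \<subseteq> I \<longrightarrow> (\<Sum>k\<in>\<D>. Sup k - Inf k) < \<delta> \<longrightarrow>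
      (\<Sum>k\<in>\<D>. norm (g (f (Sup k)) - g (f (Inf k)))) < e"
  proof (intro exI[of _ d] conjI allI impI d(1))
    fix \<D> S assume D: "\<D> division_of S" "S \<subseteq> I" "(\<Sum>k\<in>\<D>. Sup k - Inf k) < d"
    have "(\<Sum>k\<in>\<D>. norm (g (f (Sup k)) - g (f (Inf k)))) \<le> (\<Sum>k\<in>\<D>. M' * norm (f (Sup k) - f (Inf k)))"
    proof (rule sum_mono)
      fix k assume "k \<in> \<D>"
      then have "Inf k \<in> I" "Sup k \<in> I"
        using division_of_real_member[OF D(1)] D(2) by blast+
      then have "norm (g (f (Sup k)) - g (f (Inf k))) \<le> M * norm (f (Sup k) - f (Inf k))"
        by (intro g)
      also have "\<dots> \<le> M' * norm (f (Sup k) - f (Inf k))" using M' by (intro mult_right_mono) auto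
      finally show "norm (g (f (Sup k)) - g (f (Inf k))) \<le> M' * norm (f (Sup k) - f (Inf k))" .
    qed
    also have "\<dots> = M' * (\<Sum>k\<in>\<D>. norm (f (Sup k) - f (Inf k)))" by (simp add: sum_distrib_left)
    also have "\<dots> < M' * (e / M')" using d(2)[OF D] M' by (intro mult_strict_left_mono) auto
    finally show "(\<Sum>k\<in>\<D>. norm (g (f (Sup k)) - g (f (Inf k)))) < e" using M' by simp
  qed
qed

lemma abs_continuous_on_ident: "abs_continuous_on I (\<lambda>t::real. t)"
  unfolding abs_continuous_on_def
proof (intro allI impI)
  fix e :: real assume e: "e > 0"
  show "\<exists>\<delta>>0. \<forall>\<D> S. \<D> division_of S \<longrightarrow> S \<subseteq> I \<longrightarrow> (\<Sum>k\<in>\<D>. Sup k - Inf k) < \<delta> \<longrightarrow>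
      (\<Sum>k\<in>\<D>. norm (Sup k - Inf k)) < e"
  proof (intro exI[of _ e] conjI allI impI e)
    fix \<D> and S :: "real set" assume D: "\<D> division_of S" "(\<Sum>k\<in>\<D>. Sup k - Inf k) < e"
    have "(\<Sum>k\<in>\<D>. norm (Sup k - Inf k)) = (\<Sum>k\<in>\<D>. Sup k - Inf k)"
      using division_of_real_member(2)[OF D(1)] by (intro sum.cong) auto
    then show "(\<Sum>k\<in>\<D>. norm (Sup k - Inf k)) < e" using D by simp
  qed
qed

lemma lipschitz_imp_abs_continuous_on:
  fixes f :: "real \<Rightarrow> 'a::real_normed_vector"
  assumes "\<And>s t. s \<in> I \<Longrightarrow> t \<in> I \<Longrightarrow> norm (f s - f t) \<le> M * norm (s - t)"
  shows "abs_continuous_on I f"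
  using abs_continuous_on_compose_lipschitz[OF abs_continuous_on_ident[of I], of f M] assms by auto

text \<open>An increment of \<open>P (f t) (g t)\<close> splits into an increment of
  \<open>f\<close> against a bounded value of \<open>g\<close> and a bounded value of
  \<open>f\<close> against an increment of \<open>g\<close>; each part receives half of
  \<open>e\<close>.\<close>

lemma abs_continuous_on_bilinear:
  assumes "bounded_bilinear P"
    and f: "abs_continuous_on I f" "bounded (f ` I)"
    and g: "abs_continuous_on I g" "bounded (g ` I)"
  shows "abs_continuous_on I (\<lambda>t. P (f t) (g t))"
  unfolding abs_continuous_on_def
proof (intro allI impI)
  interpret P: bounded_bilinear P by fact
  fix e :: real assume e: "e > 0"
  obtain K where K: "K > 0" "\<And>x y. norm (P x y) \<le> norm x * norm y * K"
    using P.pos_bounded by blast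
  obtain F where F: "F > 0" "\<And>t. t \<in> I \<Longrightarrow> norm (f t) \<le> F"
    using f(2) by (auto simp: bounded_pos)
  obtain G where G: "G > 0" "\<And>t. t \<in> I \<Longrightarrow> norm (g t) \<le> G"
    using g(2) by (auto simp: bounded_pos)
  obtain d1 where d1: "d1 > 0"
    "\<And>\<D> S. \<D> division_of S \<Longrightarrow> S \<subseteq> I \<Longrightarrow> (\<Sum>k\<in>\<D>. Sup k - Inf k) < d1 \<Longrightarrow>
      (\<Sum>k\<in>\<D>. norm (f (Sup k) - f (Inf k))) < e / (2 * G * K)"
    using abs_continuous_onD[OF f(1), of "e / (2 * G * K)"] e G K by auto
  obtain d2 where d2: "d2 > 0"
    "\<And>\<D> S. \<D> division_of S \<Longrightarrow> S \<subseteq> I \<Longrightarrow> (\<Sum>k\<in>\<D>. Sup k - Inf k) < d2 \<Longrightarrow>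
      (\<Sum>k\<in>\<D>. norm (g (Sup k) - g (Inf k))) < e / (2 * F * K)"
    using abs_continuous_onD[OF g(1), of "e / (2 * F * K)"] e F K by auto
  show "\<exists>\<delta>>0. \<forall>\<D> S. \<D> division_of S \<longrightarrow> S \<subseteq> I \<longrightarrow> (\<Sum>k\<in>\<D>. Sup k - Inf k) < \<delta> \<longrightarrow>
      (\<Sum>k\<in>\<D>. norm (P (f (Sup k)) (g (Sup k)) - P (f (Inf k)) (g (Inf k)))) < e"
  proof (intro exI[of _ "min d1 d2"] conjI allI impI)
    fix \<D> S assume D: "\<D> division_of S" "S \<subseteq> I" "(\<Sum>k\<in>\<D>. Sup k - Inf k) < min d1 d2"
    have "(\<Sum>k\<in>\<D>. norm (P (f (Sup k)) (g (Sup k)) - P (f (Inf k)) (g (Inf k))))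
       \<le> (\<Sum>k\<in>\<D>. G * K * norm (f (Sup k) - f (Inf k)) + F * K * norm (g (Sup k) - g (Inf k)))"
    proof (rule sum_mono)
      fix k assume "k \<in> \<D>"
      then have k: "Inf k \<in> I" "Sup k \<in> I"
        using division_of_real_member[OF D(1)] D(2) by blast+
      have "P (f (Sup k)) (g (Sup k)) - P (f (Inf k)) (g (Inf k))
          = P (f (Sup k) - f (Inf k)) (g (Sup k)) + P (f (Inf k)) (g (Sup k) - g (Inf k))"
        by (simp add: P.diff_left P.diff_right)
      also have "norm \<dots> \<le> norm (f (Sup k) - f (Inf k)) * norm (g (Sup k)) * K
          + norm (f (Inf k)) * norm (g (Sup k) - g (Inf k)) * K"
        by (rule order_trans[OF norm_triangle_ineq]) (intro add_mono K)
      also have "\<dots> \<le> norm (f (Sup k) - f (Inf k)) * G * K + F * norm (g (Sup k) - g (Inf k)) * K"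
        using F(2)[OF k(1)] G(2)[OF k(2)] K(1)
        by (intro add_mono mult_right_mono mult_left_mono) auto
      finally show "norm (P (f (Sup k)) (g (Sup k)) - P (f (Inf k)) (g (Inf k)))
          \<le> G * K * norm (f (Sup k) - f (Inf k)) + F * K * norm (g (Sup k) - g (Inf k))"
        by (simp add: mult_ac)
    qed
    also have "\<dots> = G * K * (\<Sum>k\<in>\<D>. norm (f (Sup k) - f (Inf k)))
        + F * K * (\<Sum>k\<in>\<D>. norm (g (Sup k) - g (Inf k)))"
      by (simp add: sum.distrib sum_distrib_left)
    also have "\<dots> < G * K * (e / (2 * G * K)) + F * K * (e / (2 * F * K))"
      using d1(2)[OF D(1,2)] d2(2)[OF D(1,2)] D(3) F G K
      by (intro add_strict_mono mult_strict_left_mono) auto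
    also have "\<dots> = e" using F G K by simp
    finally show "(\<Sum>k\<in>\<D>. norm (P (f (Sup k)) (g (Sup k)) - P (f (Inf k)) (g (Inf k)))) < e" .
  qed (use d1 d2 in auto)
qed

lemma abs_continuous_on_imp_continuous_on:
  fixes f :: "real \<Rightarrow> 'a::real_normed_vector"
  assumes f: "abs_continuous_on {a..b} f"
  shows "continuous_on {a..b} f"
  unfolding continuous_on_iff
proof (intro ballI allI impI)
  fix t e :: real assume t: "t \<in> {a..b}" and e: "e > 0"
  obtain d where d: "d > 0"
    "\<And>\<D> S. \<D> division_of S \<Longrightarrow> S \<subseteq> {a..b} \<Longrightarrow> (\<Sum>k\<in>\<D>. Sup k - Inf k) < d \<Longrightarrow>
      (\<Sum>k\<in>\<D>. norm (f (Sup k) - f (Inf k))) < e"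
    using abs_continuous_onD[OF f e] by blast
  have *: "norm (f v - f u) < e" if "u \<in> {a..b}" "v \<in> {a..b}" "u \<le> v" "v - u < d" for u v
  proof -
    have "{{u..v}} division_of {u..v}" using division_of_self[of u v] that by simp
    from d(2)[OF this] that show ?thesis by auto
  qed
  show "\<exists>d>0. \<forall>x'\<in>{a..b}. dist x' t < d \<longrightarrow> dist (f x') (f t) < e"
  proof (intro exI[of _ d] conjI ballI impI d(1))
    fix s assume "s \<in> {a..b}" "dist s t < d"
    then show "dist (f s) (f t) < e"
      using *[of s t] *[of t s] t by (cases "s \<le> t") (auto simp: dist_norm norm_minus_commute)
  qed
qed

text \<open>
  A gauge controls the increments tagged outside the null set by the derivative; the intervals
  tagged inside it have small total length, so absolute continuity controls their increments.
\<close>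

lemma abs_continuous_on_nonincreasing:
  fixes f :: "real \<Rightarrow> real"
  assumes ab: "a \<le> b" and f: "abs_continuous_on {a..b} f" and N: "negligible N"
    and deriv: "\<And>t. t \<in> {a<..<b} - N \<Longrightarrow> \<exists>d\<le>0. (f has_vector_derivative d) (at t)"
  shows "f b \<le> f a"
proof (rule field_le_epsilon)
  fix e0 :: real assume e0: "e0 > 0"
  \<comment> \<open>The intervals tagged in the null set contribute less than \<open>e\<close>, the
    others at most \<open>e * (b - a)\<close>; together this is \<open>e0\<close>.\<close>
  define e where "e = e0 / (b - a + 1)"
  have e: "e > 0" using e0 ab by (simp add: e_def)
  \<comment> \<open>The endpoints join the exceptional set because the derivative is given only
    inside the interval.\<close>
  define Z where "Z = insert a (insert b N)"
  have Z: "negligible Z" using N by (simp add: Z_def)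
  obtain d where d: "d > 0"
    "\<And>\<D> S. \<D> division_of S \<Longrightarrow> S \<subseteq> {a..b} \<Longrightarrow> (\<Sum>k\<in>\<D>. Sup k - Inf k) < d \<Longrightarrow>
      (\<Sum>k\<in>\<D>. norm (f (Sup k) - f (Inf k))) < e"
    using abs_continuous_onD[OF f e] by blast
  have "Z \<in> sets lebesgue" using Z by (simp add: negligible_imp_sets)
  \<comment> \<open>Outer regularity: intervals tagged in \<open>Z\<close> will lie in
    \<open>U\<close>, so their total length stays below \<open>d\<close>.\<close>
  then obtain U where U: "open U" "Z \<subseteq> U" "U - Z \<in> lmeasurable" "emeasure lebesgue (U - Z) < ennreal d"
    using sets_lebesgue_outer_open d(1) by metis
  have Zl: "Z \<in> lmeasurable" using Z by (simp add: negligible_imp_measurable)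
  have Ul: "U \<in> lmeasurable"
    using fmeasurable.Un[OF U(3) Zl] U(2) by (simp add: Un_absorb2 Un_commute)
  have "measure lebesgue U \<le> measure lebesgue (U - Z) + measure lebesgue Z"
    using measure_Un_le[of "U - Z" lebesgue Z] U(2,3) Zl by (simp add: Un_absorb2 fmeasurableD)
  also have "measure lebesgue Z = 0" using Z by (simp add: negligible_imp_measure0)
  also have "measure lebesgue (U - Z) < d"
    using U(3,4) d(1) by (simp add: emeasure_eq_measure2 ennreal_less_iff)
  finally have Ud: "measure lebesgue U < d" by simp
  have "\<exists>r>0. (t \<in> Z \<longrightarrow> ball t r \<subseteq> U) \<and>
      (t \<in> {a..b} - Z \<longrightarrow> (\<forall>u v. u \<le> t \<longrightarrow> t \<le> v \<longrightarrow> {u..v} \<subseteq> ball t r \<longrightarrow> f v - f u \<le> e * (v - u)))" for t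
  proof (cases "t \<in> Z")
    case True
    then show ?thesis using U(1,2) by (meson DiffD2 open_contains_ball subsetD)
  next
    case tZ: False
    show ?thesis
    proof (cases "t \<in> {a..b}")
      case True
      then have "t \<in> {a<..<b} - N" using tZ by (auto simp: Z_def less_le)
      then obtain D where D: "D \<le> 0" "(f has_vector_derivative D) (at t)" using deriv by blast
      have "\<exists>r>0. \<forall>s. norm (s - t) < r \<longrightarrow> norm (f s - f t - (s - t) *\<^sub>R D) \<le> e * norm (s - t)"
        using D(2) e unfolding has_vector_derivative_def has_derivative_at_alt by blast
      then obtain r where r: "r > 0" "\<And>s. \<bar>s - t\<bar> < r \<Longrightarrow> \<bar>f s - f t - (s - t) * D\<bar> \<le> e * \<bar>s - t\<bar>"
        by auto
      \<comment> \<open>Straddle estimate: the tag lies between \<open>u\<close> and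
        \<open>v\<close>, so the errors \<open>e * (t - u)\<close> and \<open>e * (v - t)\<close>
        add up to \<open>e * (v - u)\<close>, while the linear part \<open>(v - u) * D\<close> is
        nonpositive.\<close>
      have "f v - f u \<le> e * (v - u)" if "u \<le> t" "t \<le> v" "{u..v} \<subseteq> ball t r" for u v
      proof -
        have "u \<in> ball t r" "v \<in> ball t r" using that by (auto intro!: subsetD[OF that(3)] simp del: mem_ball)
        then have "\<bar>u - t\<bar> < r" "\<bar>v - t\<bar> < r" by (auto simp: dist_real_def)
        then have "\<bar>f u - f t - (u - t) * D\<bar> \<le> e * (t - u)" "\<bar>f v - f t - (v - t) * D\<bar> \<le> e * (v - t)"
          using r(2)[of u] r(2)[of v] that by auto
        moreover have "(v - u) * D \<le> 0" using D(1) that by (intro mult_nonneg_nonpos) auto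
        ultimately show ?thesis by (simp add: algebra_simps)
      qed
      then show ?thesis using r(1) tZ by blast
    next
      case False
      then show ?thesis using tZ by (intro exI[of _ 1]) auto
    qed
  qed
  then obtain r where r: "\<And>t. r t > 0" "\<And>t. t \<in> Z \<Longrightarrow> ball t (r t) \<subseteq> U"
    "\<And>t u v. t \<in> {a..b} - Z \<Longrightarrow> u \<le> t \<Longrightarrow> t \<le> v \<Longrightarrow> {u..v} \<subseteq> ball t (r t) \<Longrightarrow> f v - f u \<le> e * (v - u)"
    by metis
  have "gauge (\<lambda>t. ball t (r t))" using r(1) by (simp add: gauge_ball_dependent)
  then obtain p where p: "p tagged_division_of cbox a b" "(\<lambda>t. ball t (r t)) fine p"
    using fine_division_exists by blast
  \<comment> \<open>To turn the sum over tagged pairs into a sum over intervals, the summand must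
    vanish on intervals with empty interior; for the empty set, where \<open>Sup\<close> and
    \<open>Inf\<close> carry no information, this is a convention.\<close>
  define I where "I k = (if k = {} then 0 else f (Sup k) - f (Inf k))" for k
  define p1 where "p1 = {x \<in> p. fst x \<in> Z}"
  define p2 where "p2 = {x \<in> p. fst x \<notin> Z}"
  have fin: "finite p" using p(1) by blast
  have kp: "t \<in> k \<and> k = {Inf k..Sup k} \<and> k \<subseteq> {a..b} \<and> k \<subseteq> ball t (r t)" if "(t, k) \<in> p" for t k
  proof -
    have k: "t \<in> k" "k \<subseteq> cbox a b" "\<exists>u v. k = cbox u v"
      using tagged_division_ofD(2-4)[OF p(1) that] by auto
    then obtain u v where uv: "k = {u..v}" by auto
    then have "u \<le> v" using k(1) by auto
    then show ?thesis using uv k p(2) that by (auto simp: fine_def)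
  qed
  have "f b - f a = (\<Sum>(t,k)\<in>p. f (Sup k) - f (Inf k))"
    using additive_tagged_division_1[OF ab, of p f] p(1) by simp
  also have "\<dots> = (\<Sum>(t,k)\<in>p. I k)"
    by (rule sum.cong) (auto simp: I_def dest: kp)
  also have "\<dots> = (\<Sum>(t,k)\<in>p1. I k) + (\<Sum>(t,k)\<in>p2. I k)"
    unfolding p1_def p2_def
    by (subst sum.union_disjoint[symmetric]) (use fin in \<open>auto intro!: sum.cong\<close>)
  finally have fba: "f b - f a = (\<Sum>(t,k)\<in>p1. I k) + (\<Sum>(t,k)\<in>p2. I k)" .
  have "(\<Sum>(t,k)\<in>p2. I k) \<le> (\<Sum>(t,k)\<in>p2. e * measure lborel k)"
  proof (rule sum_mono, clarify)
    fix t k assume tk: "(t, k) \<in> p2"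
    then have k: "t \<in> k" "k = {Inf k..Sup k}" "k \<subseteq> {a..b}" "k \<subseteq> ball t (r t)" and "t \<notin> Z"
      using kp[of t k] by (auto simp: p2_def)
    have "Inf k \<le> t" "t \<le> Sup k" using k(1,2) by (metis atLeastAtMost_iff)+
    moreover have "f (Sup k) - f (Inf k) \<le> e * (Sup k - Inf k)"
      by (rule r(3)[of t]) (use k \<open>t \<notin> Z\<close> calculation in auto)
    moreover have "measure lborel k = Sup k - Inf k"
      using k(2) calculation by (metis content_real order_trans)
    ultimately show "I k \<le> e * measure lborel k" using k(1) by (auto simp: I_def)
  qed
  also have "\<dots> \<le> (\<Sum>(t,k)\<in>p. e * measure lborel k)"
    by (rule sum_mono2) (use fin e in \<open>auto simp: p2_def\<close>)
  also have "\<dots> = e * (b - a)"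
    using additive_content_tagged_division[OF p(1)] ab
    by (simp add: sum_distrib_left[symmetric] case_prod_unfold)
  finally have "f b - f a \<le> (\<Sum>(t,k)\<in>p1. I k) + e * (b - a)" using fba by simp
  also have "(\<Sum>(t,k)\<in>p1. I k) < e"
  proof -
    have p1: "p1 tagged_division_of (\<Union>(snd ` p1))"
      by (rule tagged_partial_division_of_Union_self[OF tagged_partial_division_subset[of p "cbox a b"]])
        (use p(1) in \<open>auto simp: tagged_division_of_def p1_def\<close>)
    have D: "snd ` p1 division_of (\<Union>(snd ` p1))"
      using division_of_tagged_division[OF p1] .
    have sub: "\<Union>(snd ` p1) \<subseteq> {a..b}" "\<Union>(snd ` p1) \<subseteq> U"
      using kp r(2) by (fastforce simp: p1_def)+
    have "(\<Sum>k\<in>snd ` p1. Sup k - Inf k) = (\<Sum>k\<in>snd ` p1. measure lebesgue k)"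
    proof (rule sum.cong)
      fix k assume "k \<in> snd ` p1"
      then have k: "k = {Inf k..Sup k}" "Inf k \<le> Sup k"
        using division_of_real_member[OF D] by blast+
      have "measure lebesgue {Inf k..Sup k} = Sup k - Inf k" using k(2) by simp
      then show "Sup k - Inf k = measure lebesgue k" using k(1) by simp
    qed simp
    also have "\<dots> = measure lebesgue (\<Union>(snd ` p1))" using content_division[OF D] .
    also have "\<dots> \<le> measure lebesgue U"
      by (rule measure_mono_fmeasurable[OF sub(2) _ Ul]) (use lmeasurable_division[OF D] in auto)
    finally have "(\<Sum>k\<in>snd ` p1. Sup k - Inf k) < d" using Ud by simp
    from d(2)[OF D sub(1) this] have "(\<Sum>k\<in>snd ` p1. norm (f (Sup k) - f (Inf k))) < e" .
    moreover have "(\<Sum>k\<in>snd ` p1. norm (I k)) \<le> (\<Sum>k\<in>snd ` p1. norm (f (Sup k) - f (Inf k)))"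
      by (rule sum_mono) (simp add: I_def)
    moreover have "(\<Sum>(t,k)\<in>p1. I k) = (\<Sum>k\<in>snd ` p1. I k)"
      by (rule sum.over_tagged_division_lemma[OF p1])
        (auto simp: I_def not_less)
    moreover have "(\<Sum>k\<in>snd ` p1. I k) \<le> (\<Sum>k\<in>snd ` p1. norm (I k))" by (intro sum_mono) simp
    ultimately show ?thesis by simp
  qed
  finally have "f b - f a < e + e * (b - a)" using fba by simp
  also have "\<dots> = e * (b - a + 1)" by (simp add: algebra_simps)
  also have "\<dots> = e0" using ab by (simp add: e_def)
  finally show "f b \<le> f a + e0" by simp
qed

lemma abs_continuous_on_add:
  assumes f: "abs_continuous_on I f" and g: "abs_continuous_on I g"
  shows "abs_continuous_on I (\<lambda>t. f t + g t)"
  unfolding abs_continuous_on_def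
proof (intro allI impI)
  fix e :: real assume e: "e > 0"
  obtain d1 where d1: "d1 > 0"
    "\<And>\<D> S. \<D> division_of S \<Longrightarrow> S \<subseteq> I \<Longrightarrow> (\<Sum>k\<in>\<D>. Sup k - Inf k) < d1 \<Longrightarrow>
      (\<Sum>k\<in>\<D>. norm (f (Sup k) - f (Inf k))) < e / 2"
    using abs_continuous_onD[OF f, of "e / 2"] e by auto
  obtain d2 where d2: "d2 > 0"
    "\<And>\<D> S. \<D> division_of S \<Longrightarrow> S \<subseteq> I \<Longrightarrow> (\<Sum>k\<in>\<D>. Sup k - Inf k) < d2 \<Longrightarrow>
      (\<Sum>k\<in>\<D>. norm (g (Sup k) - g (Inf k))) < e / 2"
    using abs_continuous_onD[OF g, of "e / 2"] e by auto
  show "\<exists>\<delta>>0. \<forall>\<D> S. \<D> division_of S \<longrightarrow> S \<subseteq> I \<longrightarrow> (\<Sum>k\<in>\<D>. Sup k - Inf k) < \<delta> \<longrightarrow>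
      (\<Sum>k\<in>\<D>. norm (f (Sup k) + g (Sup k) - (f (Inf k) + g (Inf k)))) < e"
  proof (intro exI[of _ "min d1 d2"] conjI allI impI)
    fix \<D> S assume D: "\<D> division_of S" "S \<subseteq> I" "(\<Sum>k\<in>\<D>. Sup k - Inf k) < min d1 d2"
    have "(\<Sum>k\<in>\<D>. norm (f (Sup k) + g (Sup k) - (f (Inf k) + g (Inf k))))
       \<le> (\<Sum>k\<in>\<D>. norm (f (Sup k) - f (Inf k)) + norm (g (Sup k) - g (Inf k)))"
      by (intro sum_mono) (metis add_diff_add norm_triangle_ineq)
    also have "\<dots> < e / 2 + e / 2"
      unfolding sum.distrib using d1(2)[OF D(1,2)] d2(2)[OF D(1,2)] D(3)
      by (intro add_strict_mono) auto
    finally show "(\<Sum>k\<in>\<D>. norm (f (Sup k) + g (Sup k) - (f (Inf k) + g (Inf k)))) < e" by simp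
  qed (use d1 d2 in auto)
qed

text \<open>Projecting onto the total increment \<open>w = f b - f a\<close> reduces the claim to a
  scalar one: \<open>inner (f t) w - M * norm w * t\<close> is nonincreasing, and comparing its
  endpoint values gives \<open>(norm w)^2\<close> on the left.\<close>

lemma abs_continuous_on_norm_le:
  fixes f :: "real \<Rightarrow> 'a::real_inner"
  assumes ab: "a \<le> b" and M: "0 \<le> M" and f: "abs_continuous_on {a..b} f" and N: "negligible N"
    and deriv: "\<And>t. t \<in> {a<..<b} - N \<Longrightarrow> \<exists>d. norm d \<le> M \<and> (f has_vector_derivative d) (at t)"
  shows "norm (f b - f a) \<le> M * (b - a)"
proof (cases "f b = f a")
  case True
  then show ?thesis using M ab by simp
next
  case False
  define w where "w = f b - f a"
  have w: "norm w > 0" using False by (simp add: w_def)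
  have 1: "abs_continuous_on {a..b} (\<lambda>t. inner (f t) w)"
    by (rule abs_continuous_on_compose_lipschitz[OF f, of "\<lambda>x. inner x w" "norm w"])
      (metis inner_diff_left Cauchy_Schwarz_ineq2 mult.commute real_norm_def)
  have 2: "abs_continuous_on {a..b} (\<lambda>t. - (M * norm w * t))"
    by (rule lipschitz_imp_abs_continuous_on[of _ _ "M * norm w"])
      (use M in \<open>simp add: abs_mult minus_mult_right[symmetric] flip: right_diff_distrib add: abs_minus_commute\<close>)
  have "inner (f b) w + - (M * norm w * b) \<le> inner (f a) w + - (M * norm w * a)"
  proof (rule abs_continuous_on_nonincreasing[OF ab abs_continuous_on_add[OF 1 2] N])
    fix t assume "t \<in> {a<..<b} - N"
    then obtain d where d: "norm d \<le> M" "(f has_vector_derivative d) (at t)" using deriv by blast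
    have "inner d w \<le> norm d * norm w" by (rule norm_cauchy_schwarz)
    also have "\<dots> \<le> M * norm w" using d(1) by (intro mult_right_mono) auto
    finally have "inner d w + - (M * norm w) \<le> 0" by simp
    moreover have "((\<lambda>t. inner (f t) w + - (M * norm w * t)) has_vector_derivative inner d w + - (M * norm w)) (at t)"
      by (intro has_vector_derivative_add bounded_linear.has_vector_derivative[OF bounded_linear_inner_left d(2)])
        (auto intro!: derivative_eq_intros simp: has_real_derivative_iff_has_vector_derivative[symmetric])
    ultimately show "\<exists>d\<le>0. ((\<lambda>t. inner (f t) w + - (M * norm w * t)) has_vector_derivative d) (at t)"
      by blast
  qed
  then have "inner w w \<le> M * norm w * (b - a)"
    by (simp add: w_def inner_diff_left algebra_simps)
  then have "norm w * norm w \<le> norm w * (M * (b - a))"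
    by (simp add: power2_norm_eq_inner[symmetric] power2_eq_square mult_ac)
  then show ?thesis using w by (simp add: w_def[symmetric])
qed

lemma exp_lipschitz_atMost:
  fixes x y :: real
  assumes "x \<le> c" "y \<le> c"
  shows "\<bar>exp x - exp y\<bar> \<le> exp c * \<bar>x - y\<bar>"
proof -
  have *: "\<bar>exp u - exp v\<bar> \<le> exp c * \<bar>u - v\<bar>" if "v \<le> u" "u \<le> c" for u v :: real
  proof -
    have "exp u - exp v = exp u * (1 - exp (v - u))"
      by (simp add: right_diff_distrib exp_diff)
    also have "\<dots> \<le> exp u * (u - v)"
    proof (intro mult_left_mono)
      show "1 - exp (v - u) \<le> u - v" using exp_ge_add_one_self[of "v - u"] by linarith
    qed simp
    also have "\<dots> \<le> exp c * (u - v)" using that by (intro mult_right_mono) auto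
    finally show ?thesis using that by simp
  qed
  show ?thesis using *[of x y] *[of y x] assms by (cases "x \<le> y") (auto simp: abs_minus_commute)
qed

text \<open>Integrating factor: \<open>exp (k * t) * (f t - d / k)\<close> has nonpositive
  derivative almost everywhere. Measuring \<open>f\<close> from the equilibrium \<open>d / k\<close>
  keeps the estimate composable over many flow intervals without accumulating constants.\<close>

lemma abs_continuous_on_gronwall:
  fixes f :: "real \<Rightarrow> real"
  assumes ab: "a \<le> b" and k: "k > 0"
    and f: "abs_continuous_on {a..b} f" and N: "negligible N"
    and deriv: "\<And>t. t \<in> {a<..<b} - N \<Longrightarrow> \<exists>D. D \<le> - k * f t + d \<and> (f has_vector_derivative D) (at t)"
  shows "f b - d / k \<le> exp (- k * (b - a)) * (f a - d / k)"
proof -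
  have 1: "abs_continuous_on {a..b} (\<lambda>t. exp (k * t))"
  proof (rule lipschitz_imp_abs_continuous_on[of _ _ "exp (k * b) * k"])
    fix s t assume "s \<in> {a..b}" "t \<in> {a..b}"
    then have "\<bar>exp (k * s) - exp (k * t)\<bar> \<le> exp (k * b) * \<bar>k * s - k * t\<bar>"
      using k by (intro exp_lipschitz_atMost) auto
    then show "norm (exp (k * s) - exp (k * t)) \<le> exp (k * b) * k * norm (s - t)"
      using k by (simp add: right_diff_distrib[symmetric] abs_mult mult.assoc)
  qed
  have 2: "abs_continuous_on {a..b} (\<lambda>t. f t - d / k)"
    by (rule abs_continuous_on_compose_lipschitz[OF f, of "\<lambda>x. x - d / k" 1]) simp
  have bd: "bounded (h ` {a..b})" if "abs_continuous_on {a..b} h" for h :: "real \<Rightarrow> real"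
    using that by (intro compact_imp_bounded compact_continuous_image abs_continuous_on_imp_continuous_on) auto
  have 3: "abs_continuous_on {a..b} (\<lambda>t. exp (k * t) * (f t - d / k))"
    by (rule abs_continuous_on_bilinear[OF bounded_bilinear_mult 1 bd[OF 1] 2 bd[OF 2]])
  have "exp (k * b) * (f b - d / k) \<le> exp (k * a) * (f a - d / k)"
  proof (rule abs_continuous_on_nonincreasing[OF ab 3 N])
    fix t assume "t \<in> {a<..<b} - N"
    then obtain D where D: "D \<le> - k * f t + d" "(f has_vector_derivative D) (at t)" using deriv by blast
    have "((\<lambda>t. exp (k * t) * (f t - d / k)) has_vector_derivative
        exp (k * t) * D + exp (k * t) * k * (f t - d / k)) (at t)"
      using D(2) unfolding has_real_derivative_iff_has_vector_derivative[symmetric]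
      by (auto intro!: derivative_eq_intros)
    moreover have "exp (k * t) * D + exp (k * t) * k * (f t - d / k) = exp (k * t) * (D + k * f t - d)"
      using k by (simp add: algebra_simps)
    moreover have "exp (k * t) * (D + k * f t - d) \<le> 0"
      using D(1) by (intro mult_nonneg_nonpos) auto
    ultimately show "\<exists>D\<le>0. ((\<lambda>t. exp (k * t) * (f t - d / k)) has_vector_derivative D) (at t)"
      by auto
  qed
  then have "exp (- (k * b)) * (exp (k * b) * (f b - d / k)) \<le> exp (- (k * b)) * (exp (k * a) * (f a - d / k))"
    by (intro mult_left_mono) auto
  then show ?thesis
    unfolding mult.assoc[symmetric] exp_add[symmetric] by (simp add: right_diff_distrib)
qed

lemma AE_lebesgue_negligible:
  assumes "AE t in lebesgue. P t"
  obtains N where "negligible N" "\<And>t. t \<notin> N \<Longrightarrow> P t"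
  using assms unfolding eventually_ae_filter
  by (auto simp: negligible_iff_null_sets)

section \<open>Local solutions of linear differential equations\<close>

text \<open>Picard's fixed point argument. The contraction acts on bounded continuous functions on
  the whole line, which form a complete space.\<close>

lemma linear_ode_local_solution:
  fixes L :: "'a::banach \<Rightarrow> 'a" and w :: "real \<Rightarrow> 'a"
  assumes L: "bounded_linear L" and w: "continuous_on {T..} w"
  obtains h y where "h > 0" "y T = y0" "continuous_on {T..T + h} y"
    "\<forall>t\<in>{T..T + h}. (y has_vector_derivative L (y t) + w t) (at t within {T..T + h})"
proof -
  interpret L: bounded_linear L by fact
  obtain K where K: "K > 0" "\<And>x. norm (L x) \<le> norm x * K" using L.pos_bounded by blast
  \<comment> \<open>This length makes the contraction factor \<open>K * h\<close> equal to 1/2,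
    whatever the initial value and \<open>w\<close> are.\<close>
  define h where "h = 1 / (2 * K)"
  have h: "h > 0" "K * h = 1 / 2" using K by (auto simp: h_def)
  \<comment> \<open>Clamping time to the interval extends the Picard integral to a bounded
    continuous function on the line.\<close>
  define g where "g t = max T (min t (T + h))" for t
  have gS: "g t \<in> {T..T + h}" for t using h by (auto simp: g_def)
  have g_id: "g t = t" if "t \<in> {T..T + h}" for t using that by (auto simp: g_def)
  have gc: "continuous_on UNIV g" unfolding g_def by (intro continuous_intros)
  define I where "I f t = y0 + integral {T..t} (\<lambda>s. L (apply_bcontfun f s) + w s)"
    for f :: "real \<Rightarrow>\<^sub>C 'a" and t
  have integrand: "continuous_on {T..b} (\<lambda>s. L (apply_bcontfun f s) + w s)"
    for f :: "real \<Rightarrow>\<^sub>C 'a" and b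
    by (intro continuous_intros L.continuous_on continuous_on_subset[OF w]) auto
  have Ic: "continuous_on {T..T + h} (I f)" for f
    unfolding I_def
    by (intro continuous_intros indefinite_integral_continuous_1 integrable_continuous_real integrand)
  have Ig: "(\<lambda>t. I f (g t)) \<in> bcontfun" for f
  proof -
    have "continuous_on UNIV (\<lambda>t. I f (g t))"
      by (rule continuous_on_compose2[OF Ic gc]) (use gS in auto)
    moreover have "bounded (I f ` {T..T + h})"
      by (intro compact_imp_bounded compact_continuous_image Ic) auto
    then have "bounded (range (\<lambda>t. I f (g t)))"
      by (rule bounded_subset) (use gS in auto)
    ultimately show ?thesis by (simp add: bcontfun_def)
  qed
  define Phi where "Phi f = Bcontfun (\<lambda>t. I f (g t))" for f
  have Phi: "apply_bcontfun (Phi f) t = I f (g t)" for f t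
    unfolding Phi_def using Ig by (simp add: Bcontfun_inverse)
  have "dist (Phi f) (Phi f') \<le> 1 / 2 * dist f f'" for f f'
  proof (rule dist_bound)
    fix t
    let ?d = "\<lambda>s. L (apply_bcontfun f s - apply_bcontfun f' s)"
    have "I f (g t) - I f' (g t) = integral {T..g t} (\<lambda>s. (L (apply_bcontfun f s) + w s) - (L (apply_bcontfun f' s) + w s))"
      unfolding I_def
      by (subst Henstock_Kurzweil_Integration.integral_diff) (auto intro!: integrable_continuous_real integrand)
    also have "\<dots> = integral {T..g t} ?d" by (simp add: L.diff)
    also have "norm \<dots> \<le> (dist f f' * K) * (g t - T)"
    proof (rule integral_bound)
      show "T \<le> g t" using gS by auto
      show "continuous_on {T..g t} ?d" by (intro continuous_intros L.continuous_on) auto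
      fix s
      have "norm (?d s) \<le> norm (apply_bcontfun f s - apply_bcontfun f' s) * K" by (rule K)
      also have "\<dots> \<le> dist f f' * K"
        using K(1) dist_bounded[of f s f'] by (simp add: dist_norm)
      finally show "norm (?d s) \<le> dist f f' * K" .
    qed
    also have "\<dots> \<le> (dist f f' * K) * h"
      using gS[of t] K(1) by (intro mult_left_mono) auto
    also have "\<dots> = 1 / 2 * dist f f'" using h(2) by simp
    finally show "dist (apply_bcontfun (Phi f) t) (apply_bcontfun (Phi f') t) \<le> 1 / 2 * dist f f'"
      by (simp add: Phi dist_norm)
  qed
  then have "\<exists>!f. Phi f = f" by (intro banach_fix_type[of "1/2"]) auto
  then obtain f where f: "Phi f = f" by blast
  have fI: "apply_bcontfun f t = I f t" if "t \<in> {T..T + h}" for t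
    using Phi[of f t] f g_id[OF that] by simp
  show ?thesis
  proof (rule that[OF h(1)])
    show "apply_bcontfun f T = y0" using fI[of T] h by (simp add: I_def)
    show "continuous_on {T..T + h} (apply_bcontfun f)" by simp
    show "\<forall>t\<in>{T..T + h}. (apply_bcontfun f has_vector_derivative L (apply_bcontfun f t) + w t)
        (at t within {T..T + h})"
    proof
      fix t assume t: "t \<in> {T..T + h}"
      have "(I f has_vector_derivative 0 + (L (apply_bcontfun f t) + w t)) (at t within {T..T + h})"
        unfolding I_def
        by (intro has_vector_derivative_add has_vector_derivative_const integral_has_vector_derivative integrand t)
      then show "(apply_bcontfun f has_vector_derivative L (apply_bcontfun f t) + w t) (at t within {T..T + h})"
        using fI t by (auto intro: has_vector_derivative_transform)
    qed
  qed
qed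

section \<open>Hybrid time domains and extension of solutions\<close>

lemma negligible_AE_lebesgue:
  assumes "negligible N" "\<And>t. t \<notin> N \<Longrightarrow> P t"
  shows "AE t in lebesgue. P t"
  by (rule AE_I'[of N]) (use assms in \<open>auto simp: negligible_iff_null_sets\<close>)

definition staircase :: "nat \<Rightarrow> (nat \<Rightarrow> real) \<Rightarrow> (real \<times> nat) set" where
  "staircase J t = (\<Union>j<J. {t j..t (Suc j)} \<times> {j})"

lemma mem_staircase: "(s, j) \<in> staircase J t \<longleftrightarrow> j < J \<and> t j \<le> s \<and> s \<le> t (Suc j)"
  by (auto simp: staircase_def)

lemma compact_hybrid_time_domain_staircase:
  "compact_hybrid_time_domain E \<longleftrightarrow>
    (\<exists>J t. 1 \<le> J \<and> t 0 = 0 \<and> (\<forall>j<J. t j \<le> t (Suc j)) \<and> E = staircase J t)"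
  unfolding compact_hybrid_time_domain_def staircase_def ..

text \<open>A finite subset of an increasing union lies in a single member, so questions about
  finitely many points of any domain concern finitely many breakpoints.\<close>

lemma hybrid_time_domain_witness:
  assumes "hybrid_time_domain E" "X \<subseteq> E" "finite X"
  obtains J t where "1 \<le> J" "t 0 = 0" "\<forall>j<J. t j \<le> t (Suc j)" "staircase J t \<subseteq> E" "X \<subseteq> staircase J t"
proof -
  obtain S where S: "\<And>k. compact_hybrid_time_domain (S k)" "incseq S" "E = (\<Union>k. S k)"
    using assms(1) unfolding hybrid_time_domain_def by blast
  have "\<exists>k. X \<subseteq> S k"
    using assms(3,2)
  proof (induction X)
    case (insert x X)
    then obtain k m where "X \<subseteq> S k" "x \<in> S m" using S(3) by auto
    then have "insert x X \<subseteq> S (max k m)"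
      using incseqD[OF S(2), of k "max k m"] incseqD[OF S(2), of m "max k m"] by auto
    then show ?case by blast
  qed simp
  then obtain k where k: "X \<subseteq> S k" by blast
  obtain J t where "1 \<le> J" "t 0 = 0" "\<forall>j<J. t j \<le> t (Suc j)" "S k = staircase J t"
    using S(1)[of k] unfolding compact_hybrid_time_domain_staircase by blast
  with k S(3) show ?thesis by (intro that[of J t]) auto
qed

text \<open>Follows the breakpoints from \<open>(0, 0)\<close> to \<open>(t, j)\<close>. Intervals
  of zero length are absorbed here, so users treat only segments with \<open>s < t\<close>.\<close>

lemma hybrid_time_domain_induct [consumes 2, case_names init flow jump]:
  assumes E: "hybrid_time_domain E" and tj: "(t, j) \<in> E"
    and init: "P 0 0"
    and flow: "\<And>s t j. s < t \<Longrightarrow> {s..t} \<times> {j} \<subseteq> E \<Longrightarrow> P s j \<Longrightarrow> P t j"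
    and jump: "\<And>t j. (t, j) \<in> E \<Longrightarrow> (t, Suc j) \<in> E \<Longrightarrow> P t j \<Longrightarrow> P t (Suc j)"
  shows "P t j"
proof -
  obtain J T where T: "T 0 = 0" "\<forall>j<J. T j \<le> T (Suc j)" "staircase J T \<subseteq> E" "(t, j) \<in> staircase J T"
    using hybrid_time_domain_witness[OF E, of "{(t, j)}"] tj by (metis empty_subsetI finite.emptyI finite.insertI insert_subset)
  have fl: "P s i" if "(s, i) \<in> staircase J T" "P (T i) i" for s i
  proof (cases "T i = s")
    case False
    then have "T i < s" using that by (auto simp: mem_staircase)
    moreover have "{T i..s} \<times> {i} \<subseteq> E" using that T(3) by (auto simp: mem_staircase)
    ultimately show ?thesis using flow that(2) by blast
  qed (use that in simp)
  have "P (T i) i" if "i < J" for i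
    using that
  proof (induction i)
    case 0
    then show ?case using init T(1) by simp
  next
    case (Suc i)
    have 1: "(T (Suc i), i) \<in> staircase J T" "(T (Suc i), Suc i) \<in> staircase J T"
      using Suc.prems T(2) by (auto simp: mem_staircase)
    then have "P (T (Suc i)) i" using fl Suc by simp
    then show ?case using jump 1 T(3) by blast
  qed
  then show ?thesis using fl T(4) by (auto simp: mem_staircase)
qed

lemma hybrid_time_domain_zero: "hybrid_time_domain E \<Longrightarrow> (0, 0) \<in> E"
  by (rule hybrid_time_domain_witness[of E "{}"]) (auto simp: mem_staircase subset_iff)

lemma hybrid_time_domain_nonneg:
  assumes "hybrid_time_domain E" "(t, j) \<in> E"
  shows "0 \<le> t"
  using assms
proof (induction rule: hybrid_time_domain_induct)
qed auto

text \<open>Boundedness limits the number of jumps, hence there is a last index \<open>J\<close>.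
  Earlier intervals are closed by the next jump time, so only the final endpoint \<open>T\<close>
  can be missing. Membership of \<open>(T, J)\<close> is therefore left open.\<close>

lemma incomplete_hybrid_time_domain:
  assumes E: "hybrid_time_domain E" and inc: "\<not> complete_time_domain E"
  obtains J t T where "t 0 = 0" "\<And>j. j < J \<Longrightarrow> t j \<le> t (Suc j)" "t J \<le> T" "(t J, J) \<in> E"
    "\<And>s j. j < J \<Longrightarrow> (s, j) \<in> E \<longleftrightarrow> t j \<le> s \<and> s \<le> t (Suc j)"
    "\<And>s. (s, J) \<in> E \<Longrightarrow> t J \<le> s \<and> s \<le> T" "\<And>s. t J \<le> s \<Longrightarrow> s < T \<Longrightarrow> (s, J) \<in> E"
    "\<And>s j. J < j \<Longrightarrow> (s, j) \<notin> E"
proof -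
  obtain c where c: "\<And>s j. (s, j) \<in> E \<Longrightarrow> norm (s, real j) \<le> c"
    using inc unfolding complete_time_domain_def by blast
  have c1: "s \<le> c" and c2: "real j \<le> c" if "(s, j) \<in> E" for s j
    using c[OF that] norm_fst_le[of s "real j"] norm_snd_le[of "real j" s] by auto
  define Js where "Js = {j. \<exists>s. (s, j) \<in> E}"
  have "Js \<subseteq> {..nat \<lfloor>c\<rfloor>}" using c2 by (auto simp: Js_def le_nat_floor)
  then have fin: "finite Js" using finite_subset by blast
  have ne: "Js \<noteq> {}" using hybrid_time_domain_zero[OF E] by (auto simp: Js_def)
  define J where "J = Max Js"
  have J1: "j \<le> J" if "(s, j) \<in> E" for s j
    unfolding J_def by (rule Max_ge[OF fin]) (use that in \<open>auto simp: Js_def\<close>)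
  obtain s0 where s0: "(s0, J) \<in> E" using Max_in[OF fin ne] by (auto simp: J_def Js_def)
  \<comment> \<open>Including a point of index \<open>J\<close> forces at least \<open>Suc J\<close>
    intervals, and maximality of \<open>J\<close> forbids more.\<close>
  have wit: "\<exists>t. t 0 = 0 \<and> (\<forall>j<Suc J. t j \<le> t (Suc j)) \<and> staircase (Suc J) t \<subseteq> E \<and> X \<subseteq> staircase (Suc J) t"
    if X: "X \<subseteq> E" "finite X" for X
  proof -
    obtain J' t where t: "t 0 = 0" "\<forall>j<J'. t j \<le> t (Suc j)" "staircase J' t \<subseteq> E" "insert (s0, J) X \<subseteq> staircase J' t"
      using hybrid_time_domain_witness[OF E, of "insert (s0, J) X"] s0 X by (metis finite.insertI insert_subset)
    have "J < J'" using t(4) by (auto simp: mem_staircase)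
    moreover have "J' \<le> Suc J"
    proof (rule ccontr)
      assume "\<not> J' \<le> Suc J"
      then have "(t (Suc J), Suc J) \<in> staircase J' t" using t(2) by (auto simp: mem_staircase)
      then show False using J1 t(3) by fastforce
    qed
    ultimately have "J' = Suc J" by simp
    then show ?thesis using t by auto
  qed
  obtain t where t: "t 0 = 0" "\<forall>j<Suc J. t j \<le> t (Suc j)" "staircase (Suc J) t \<subseteq> E"
    using wit[of "{}"] by auto
  define T where "T = Sup {s. (s, J) \<in> E}"
  have bdd: "bdd_above {s. (s, J) \<in> E}" by (rule bdd_aboveI[of _ c]) (use c1 in auto)
  have tJ: "(t J, J) \<in> E" using t by (auto simp: mem_staircase subset_iff)
  \<comment> \<open>Requiring both ends of every interval of \<open>t\<close> to belong to the new
    staircase pins its breakpoints up to \<open>J\<close>; only the last endpoint may vary with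
    \<open>X\<close>.\<close>
  have common: "\<exists>t'. (\<forall>i\<le>J. t' i = t i) \<and> (\<forall>x\<in>X. x \<in> staircase (Suc J) t') \<and> staircase (Suc J) t' \<subseteq> E"
    if X: "X \<subseteq> E" "finite X" for X
  proof -
    let ?Y = "(\<lambda>i. (t i, i)) ` {..J} \<union> (\<lambda>i. (t (Suc i), i)) ` {..J}"
    have "?Y \<subseteq> E" using t(2,3) by (auto simp: mem_staircase subset_iff)
    then obtain t' where t': "t' 0 = 0" "staircase (Suc J) t' \<subseteq> E" "X \<union> ?Y \<subseteq> staircase (Suc J) t'"
      using wit[of "X \<union> ?Y"] X by auto
    have "t' i = t i" if "i \<le> J" for i
    proof (cases i)
      case 0
      then show ?thesis using t t' by simp
    next
      case (Suc k)
      have "(t i, i) \<in> staircase (Suc J) t'" "(t (Suc k), k) \<in> staircase (Suc J) t'"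
        using t'(3) that Suc by auto
      then show ?thesis using Suc by (auto simp: mem_staircase)
    qed
    then show ?thesis using t' by blast
  qed
  show ?thesis
  proof (rule that[of t J T])
    show "t 0 = 0" "(t J, J) \<in> E" by fact+
    show "t j \<le> t (Suc j)" if "j < J" for j using t(2) that by simp
    show ub: "t J \<le> s \<and> s \<le> T" if s: "(s, J) \<in> E" for s
    proof
      show "s \<le> T" unfolding T_def using s bdd by (intro cSup_upper) auto
      obtain t' where "\<forall>i\<le>J. t' i = t i" "(s, J) \<in> staircase (Suc J) t'"
        using common[of "{(s, J)}"] s by auto
      then show "t J \<le> s" by (auto simp: mem_staircase)
    qed
    show "t J \<le> T" using ub[OF tJ] by simp
    show "(s, j) \<in> E \<longleftrightarrow> t j \<le> s \<and> s \<le> t (Suc j)" if j: "j < J" for s j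
    proof
      assume s: "(s, j) \<in> E"
      obtain t' where "\<forall>i\<le>J. t' i = t i" "(s, j) \<in> staircase (Suc J) t'"
        using common[of "{(s, j)}"] s by auto
      then show "t j \<le> s \<and> s \<le> t (Suc j)" using j by (auto simp: mem_staircase)
    next
      assume "t j \<le> s \<and> s \<le> t (Suc j)"
      then show "(s, j) \<in> E" using t(3) j by (auto simp: mem_staircase subset_iff)
    qed
    show "(s, J) \<in> E" if s: "t J \<le> s" "s < T" for s
    proof -
      obtain s' where s': "(s', J) \<in> E" "s < s'"
        using s(2) tJ unfolding T_def by (subst (asm) less_cSup_iff[OF _ bdd]) auto
      obtain t' where t': "\<forall>i\<le>J. t' i = t i" "(s', J) \<in> staircase (Suc J) t'" "staircase (Suc J) t' \<subseteq> E"
        using common[of "{(s', J)}"] s' by auto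
      then have "(s, J) \<in> staircase (Suc J) t'" using s s' by (auto simp: mem_staircase)
      then show ?thesis using t'(3) by blast
    qed
    show "(s, j) \<notin> E" if "J < j" for s j using J1 that by fastforce
  qed
qed

section \<open>Solutions on a flow interval and their extension\<close>

lemma hybrid_solution_abs_continuous:
  assumes "hybrid_solution H u E \<xi>" "{s..t} \<times> {j} \<subseteq> E"
  shows "abs_continuous_on {s..t} (\<lambda>r. \<xi> r j)"
proof -
  have "{s..t} \<subseteq> flow_times E j" using assms(2) by (auto simp: flow_times_def)
  then show ?thesis
    using assms(1) unfolding hybrid_solution_def loc_abs_continuous_on_def by blast
qed

text \<open>Inside an open segment the derivative relative to the flow interval is two-sided, which
  is the form the monotonicity results require.\<close>

lemma hybrid_solution_flow:
  assumes sol: "hybrid_solution H u E \<xi>" and st: "{s<..<t} \<times> {j} \<subseteq> E"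
  obtains N where "negligible N" "\<forall>r\<in>{s<..<t}. \<xi> r j \<in> flow_set H"
    "\<forall>r\<in>{s<..<t} - N.
      \<exists>w\<in>flow_map H (\<xi> r j) (u r). ((\<lambda>r. \<xi> r j) has_vector_derivative w) (at r)"
proof (cases "s < t")
  case False
  then show ?thesis by (intro that[of "{}"]) auto
next
  case True
  have sub: "{s<..<t} \<subseteq> flow_times E j" using st by (auto simp: flow_times_def)
  have int: "{s<..<t} \<subseteq> interior (flow_times E j)"
    by (rule interior_maximal) (use sub in auto)
  then have ne: "interior (flow_times E j) \<noteq> {}" using True dense by fastforce
  have "AE r in lebesgue. r \<in> flow_times E j \<longrightarrow>
     (\<exists>w\<in>flow_map H (\<xi> r j) (u r). ((\<lambda>r. \<xi> r j) has_vector_derivative w) (at r within flow_times E j))"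
    using sol ne unfolding hybrid_solution_def by blast
  then obtain N where N: "negligible N" "\<And>r. r \<notin> N \<Longrightarrow> r \<in> flow_times E j \<longrightarrow>
     (\<exists>w\<in>flow_map H (\<xi> r j) (u r). ((\<lambda>r. \<xi> r j) has_vector_derivative w) (at r within flow_times E j))"
    by (rule AE_lebesgue_negligible) blast
  show ?thesis
  proof (rule that[OF N(1)])
    show "\<forall>r\<in>{s<..<t}. \<xi> r j \<in> flow_set H"
      using sol ne int unfolding hybrid_solution_def by blast
    show "\<forall>r\<in>{s<..<t} - N.
      \<exists>w\<in>flow_map H (\<xi> r j) (u r). ((\<lambda>r. \<xi> r j) has_vector_derivative w) (at r)"
    proof
      fix r assume r: "r \<in> {s<..<t} - N"
      have "r \<in> interior (flow_times E j)" using r int by blast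
      then have "at r within flow_times E j = at r" by (rule at_within_interior)
      moreover have "r \<in> flow_times E j" using r sub by auto
      ultimately show "\<exists>w\<in>flow_map H (\<xi> r j) (u r). ((\<lambda>r. \<xi> r j) has_vector_derivative w) (at r)"
        using N(2)[of r] r by auto
    qed
  qed
qed

text \<open>Solutions are constrained only in the interior of the flow interval; continuity and
  closedness carry the constraint to the endpoints.\<close>

lemma hybrid_solution_flow_set:
  assumes sol: "hybrid_solution H u E \<xi>" and cl: "closed (flow_set H)"
    and st: "s < t" "{s..t} \<times> {j} \<subseteq> E" and r: "r \<in> {s..t}"
  shows "\<xi> r j \<in> flow_set H"
proof -
  have "{s<..<t} \<times> {j} \<subseteq> E" using st(2) by auto
  then obtain N where N: "\<forall>r\<in>{s<..<t}. \<xi> r j \<in> flow_set H"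
    by (rule hybrid_solution_flow[OF sol]) (rule that)
  have "continuous_on (closure {s<..<t}) (\<lambda>r. \<xi> r j)"
    using abs_continuous_on_imp_continuous_on[OF hybrid_solution_abs_continuous[OF sol st(2)]] st(1) by simp
  then have "(\<lambda>r. \<xi> r j) ` closure {s<..<t} \<subseteq> flow_set H"
    by (rule image_closure_subset[OF _ cl]) (use N in auto)
  then show ?thesis using r st(1) by auto
qed

text \<open>Here \<open>T\<close> is the end of the extended arc. Replacing the whole last flow by
  \<open>g\<close> covers both adding a missing endpoint and flowing past an existing one; since
  \<open>J\<close> remains the last index, the jump conditions are inherited.\<close>

lemma hybrid_solution_extend:
  fixes H :: "('s::real_normed_vector, 'u) hybrid_system"
  assumes sol: "hybrid_solution H u E \<xi>"
    and dom: "t 0 = 0" "\<And>j. j < J \<Longrightarrow> t j \<le> t (Suc j)" "t J \<le> T" "(t J, J) \<in> E"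
      "\<And>s j. j < J \<Longrightarrow> (s, j) \<in> E \<longleftrightarrow> t j \<le> s \<and> s \<le> t (Suc j)"
      "\<And>s. (s, J) \<in> E \<Longrightarrow> t J \<le> s \<and> s \<le> T"
      "\<And>s j. J < j \<Longrightarrow> (s, j) \<notin> E"
    and g: "\<And>s. (s, J) \<in> E \<Longrightarrow> g s = \<xi> s J"
      "abs_continuous_on {t J..T} g" "\<And>s. s \<in> {t J<..<T} \<Longrightarrow> g s \<in> flow_set H"
      "negligible N"
      "\<And>s. s \<in> {t J<..<T} - N \<Longrightarrow> \<exists>w\<in>flow_map H (g s) (u s). (g has_vector_derivative w) (at s)"
  defines "E' \<equiv> E \<union> {t J..T} \<times> {J}" and "\<xi>' \<equiv> \<lambda>s j. if j = J then g s else \<xi> s j"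
  shows "hybrid_solution H u E' \<xi>'" "\<And>s j. (s, j) \<in> E \<Longrightarrow> \<xi>' s j = \<xi> s j"
proof -
  show agree: "\<xi>' s j = \<xi> s j" if "(s, j) \<in> E" for s j
    using that g(1) by (auto simp: \<xi>'_def)
  define t' where "t' = t(Suc J := T)"
  have "E' = staircase (Suc J) t'"
  proof (rule set_eqI, clarify)
    fix s j
    show "(s, j) \<in> E' \<longleftrightarrow> (s, j) \<in> staircase (Suc J) t'"
      using dom(5)[of j s] dom(6)[of s] dom(7)[of j s]
      by (cases j J rule: linorder_cases) (auto simp: E'_def mem_staircase t'_def)
  qed
  then have "compact_hybrid_time_domain E'"
    unfolding compact_hybrid_time_domain_staircase
    by (intro exI[of _ "Suc J"] exI[of _ t']) (use dom in \<open>auto simp: t'_def less_Suc_eq\<close>)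
  then have htd: "hybrid_time_domain E'"
    unfolding hybrid_time_domain_def by (intro exI[of _ "\<lambda>k. E'"]) (auto simp: incseq_def)
  have ftJ: "flow_times E' J = {t J..T}"
    using dom(6) by (auto simp: E'_def flow_times_def)
  have ft: "flow_times E' j = flow_times E j" if "j \<noteq> J" for j
    using that by (auto simp: E'_def flow_times_def)
  have init: "\<xi>' 0 0 = \<xi> 0 0"
    using sol hybrid_time_domain_zero agree unfolding hybrid_solution_def by blast
  show "hybrid_solution H u E' \<xi>'"
    unfolding hybrid_solution_def
  proof (intro conjI allI impI htd)
    fix j
    show "loc_abs_continuous_on (flow_times E' j) (\<lambda>s. \<xi>' s j)"
    proof (cases "j = J")
      case True
      then show ?thesis
        using g(2) ftJ by (auto simp: \<xi>'_def loc_abs_continuous_on_def intro: abs_continuous_on_subset)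
    next
      case False
      then show ?thesis using sol ft by (simp add: \<xi>'_def hybrid_solution_def)
    qed
  next
    show "\<xi>' 0 0 \<in> closure (flow_set H) \<union> jump_set H"
      unfolding init using sol unfolding hybrid_solution_def by blast
  next
    fix j assume ne: "interior (flow_times E' j) \<noteq> {}"
    show "\<forall>s\<in>interior (flow_times E' j). \<xi>' s j \<in> flow_set H"
    proof (cases "j = J")
      case True
      then show ?thesis using g(3) ftJ by (simp add: \<xi>'_def)
    next
      case False
      then show ?thesis using sol ft ne by (simp add: \<xi>'_def hybrid_solution_def)
    qed
    show "AE s in lebesgue. s \<in> flow_times E' j \<longrightarrow>
      (\<exists>w\<in>flow_map H (\<xi>' s j) (u s).
          ((\<lambda>s. \<xi>' s j) has_vector_derivative w) (at s within flow_times E' j))"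
    proof (cases "j = J")
      case True
      show ?thesis
      proof (rule negligible_AE_lebesgue[of "insert (t J) (insert T N)"], use g(4) in simp, intro impI)
        fix s assume "s \<notin> insert (t J) (insert T N)" "s \<in> flow_times E' j"
        then have "s \<in> {t J<..<T} - N" using ftJ True by auto
        then show "\<exists>w\<in>flow_map H (\<xi>' s j) (u s).
          ((\<lambda>s. \<xi>' s j) has_vector_derivative w) (at s within flow_times E' j)"
          using g(5) True by (auto simp: \<xi>'_def intro: has_vector_derivative_at_within)
      qed
    next
      case False
      then show ?thesis using sol ft ne by (simp add: \<xi>'_def hybrid_solution_def)
    qed
  next
    fix s j assume 1: "(s, j) \<in> E'" and 2: "(s, Suc j) \<in> E'"
    \<comment> \<open>No new jump appears: the added points have index \<open>J\<close>, and a jump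
      into index \<open>J\<close> can happen only at \<open>t J\<close>, where the point was already
      present.\<close>
    have "(s, j) \<in> E \<and> (s, Suc j) \<in> E"
    proof -
      have jJ: "Suc j \<le> J" using 2 dom(7)[of "Suc j" s] by (cases "Suc j \<le> J") (auto simp: E'_def)
      then have sj: "(s, j) \<in> E" using 1 by (auto simp: E'_def)
      show ?thesis
      proof (cases "Suc j = J")
        case True
        then have "s \<le> t J" using sj dom(5)[of j s] by auto
        moreover have "t J \<le> s" using 2 True dom(6) by (auto simp: E'_def)
        ultimately show ?thesis using sj dom(4) True by simp
      next
        case False
        then show ?thesis using sj 2 by (auto simp: E'_def)
      qed
    qed
    then show "\<xi>' s j \<in> jump_set H" "\<xi>' s (Suc j) \<in> jump_map H (\<xi>' s j) (u s)"
      using sol agree unfolding hybrid_solution_def by auto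
  qed
qed

lemma maximal_hybrid_solution_no_extension:
  assumes max: "maximal_hybrid_solution H u E \<xi>" and "hybrid_solution H u E' \<xi>'" "E \<subseteq> E'"
    "\<And>s j. (s, j) \<in> E \<Longrightarrow> \<xi>' s j = \<xi> s j"
  shows "E' = E"
  using assms unfolding maximal_hybrid_solution_def by blast

section \<open>The switched system\<close>

lemma abs_continuous_on_bounded_linear:
  assumes "bounded_linear g" "abs_continuous_on I f"
  shows "abs_continuous_on I (\<lambda>t. g (f t))"
proof -
  interpret g: bounded_linear g by fact
  obtain M where "\<And>x. norm (g x) \<le> norm x * M" using g.bounded by blast
  then show ?thesis
    by (intro abs_continuous_on_compose_lipschitz[OF assms(2), of g M]) (metis g.diff mult.commute)
qed

lemma bounded_linear_fst_snd: "bounded_linear (\<lambda>x. fst (snd x))"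
  by (rule bounded_linear_compose[OF bounded_linear_fst bounded_linear_snd])

lemma bounded_linear_snd_snd: "bounded_linear (\<lambda>x. snd (snd x))"
  by (rule bounded_linear_compose[OF bounded_linear_snd bounded_linear_snd])

lemma closed_switched_flow_set: "closed (flow_set (switched_system l A B b N0 \<eta>))"
  by (simp add: switched_system_def closed_Times finite_imp_closed)

lemma mem_switched_flow_set:
  "(x \<in> flow_set (switched_system l A B b N0 \<eta>)) \<longleftrightarrow>
    fst (snd x) \<in> real ` {1..l} \<and> snd (snd x) \<in> {0..N0}"
  by (cases x) (auto simp: switched_system_def)

text \<open>The nearest point of the attractor keeps mode and timer and replaces the continuous
  state by 0; both remaining components are admissible by assumption.\<close>

lemma infdist_attractor:
  fixes x :: "'n::finite switched_state"
  assumes "fst (snd x) \<in> real ` {1..l}" "snd (snd x) \<in> {0..N0}"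
  shows "infdist x (attractor l N0) = norm (fst x)"
proof (rule antisym)
  have "(0, snd x) \<in> (attractor l N0 :: 'n switched_state set)"
    using assms by (cases x) (auto simp: attractor_def)
  then have "infdist x (attractor l N0) \<le> dist x (0, snd x)" by (rule infdist_le)
  then show "infdist x (attractor l N0) \<le> norm (fst x)"
    by (cases x) (simp add: dist_norm norm_Pair)
  have "norm (fst x) \<le> dist x z" if "z \<in> attractor l N0" for z
    using that norm_fst_le[of "fst x" "snd x - snd z"] by (cases x) (auto simp: attractor_def dist_norm)
  then show "norm (fst x) \<le> infdist x (attractor l N0)"
    unfolding infdist_def using \<open>(0, snd x) \<in> attractor l N0\<close> by (auto intro!: cINF_greatest)
qed

text \<open>The flow map could select a different mode at each time. The mode component is
  absolutely continuous with derivative 0 almost everywhere, hence constant, so a single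
  \<open>q\<close> serves the whole segment.\<close>

lemma switched_flow:
  fixes A :: "nat \<Rightarrow> real^'n^'n" and B :: "nat \<Rightarrow> real^'m^'n"
  assumes sol: "hybrid_solution (switched_system l A B b N0 \<eta>) v E \<xi>"
    and st: "s < t" "{s..t} \<times> {j} \<subseteq> E"
  obtains q N where "q \<in> {1..l}" "abs_continuous_on {s..t} (\<lambda>r. \<xi> r j)" "negligible N"
    "\<forall>r\<in>{s..t}. fst (snd (\<xi> r j)) = real q \<and> snd (snd (\<xi> r j)) \<in> {0..N0}"
    "\<forall>r\<in>{s<..<t} - N. \<exists>\<theta>\<in>{0..\<eta>}.
      ((\<lambda>r. \<xi> r j) has_vector_derivative (A q *v fst (\<xi> r j) + B q *v v r, 0, \<theta>)) (at r)"
proof -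
  let ?H = "switched_system l A B b N0 \<eta>"
  have ac: "abs_continuous_on {s..t} (\<lambda>r. \<xi> r j)"
    by (rule hybrid_solution_abs_continuous[OF sol st(2)])
  have "{s<..<t} \<times> {j} \<subseteq> E" using st(2) by auto
  then obtain N where N: "negligible N"
    "\<forall>r\<in>{s<..<t} - N.
      \<exists>w\<in>flow_map ?H (\<xi> r j) (v r). ((\<lambda>r. \<xi> r j) has_vector_derivative w) (at r)"
    by (rule hybrid_solution_flow[OF sol]) (rule that)
  have fs: "fst (snd (\<xi> r j)) \<in> real ` {1..l} \<and> snd (snd (\<xi> r j)) \<in> {0..N0}" if "r \<in> {s..t}" for r
    using hybrid_solution_flow_set[OF sol closed_switched_flow_set st that]
    unfolding mem_switched_flow_set .
  then obtain q where q: "q \<in> {1..l}" "fst (snd (\<xi> s j)) = real q"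
    using st(1) by (metis atLeastAtMost_iff imageE less_imp_le order_refl)
  have der: "\<exists>q'\<in>{1..l}. \<exists>\<theta>\<in>{0..\<eta>}. fst (snd (\<xi> r j)) = real q' \<and>
      ((\<lambda>r. \<xi> r j) has_vector_derivative (A q' *v fst (\<xi> r j) + B q' *v v r, 0, \<theta>)) (at r)"
    if r: "r \<in> {s<..<t} - N" for r
  proof -
    obtain y p z where x: "\<xi> r j = (y, p, z)" using prod_cases3 by blast
    show ?thesis using bspec[OF N(2) r] unfolding x by (fastforce simp: switched_system_def)
  qed
  have mode: "fst (snd (\<xi> r j)) = real q" if r: "r \<in> {s..t}" for r
  proof -
    have "norm (fst (snd (\<xi> r j)) - fst (snd (\<xi> s j))) \<le> 0 * (r - s)"
    proof (rule abs_continuous_on_norm_le[OF _ _ _ N(1), where f = "\<lambda>r. fst (snd (\<xi> r j))"])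
      show "abs_continuous_on {s..r} (\<lambda>r. fst (snd (\<xi> r j)))"
        by (rule abs_continuous_on_subset[OF abs_continuous_on_bounded_linear[OF bounded_linear_fst_snd ac]])
          (use r in auto)
      fix x assume "x \<in> {s<..<r} - N"
      then have x: "x \<in> {s<..<t} - N" using r by auto
      obtain q' \<theta> where "((\<lambda>r. \<xi> r j) has_vector_derivative (A q' *v fst (\<xi> x j) + B q' *v v x, 0, \<theta>)) (at x)"
        using der[OF x] by blast
      from bounded_linear.has_vector_derivative[OF bounded_linear_fst_snd this]
      show "\<exists>d. norm d \<le> 0 \<and> ((\<lambda>r. fst (snd (\<xi> r j))) has_vector_derivative d) (at x)" by auto
    qed (use r in auto)
    then show ?thesis using q(2) by simp
  qed
  show ?thesis
  proof (rule that[OF q(1) ac N(1)])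
    show "\<forall>r\<in>{s..t}. fst (snd (\<xi> r j)) = real q \<and> snd (snd (\<xi> r j)) \<in> {0..N0}"
      using mode fs by blast
    show "\<forall>r\<in>{s<..<t} - N. \<exists>\<theta>\<in>{0..\<eta>}.
      ((\<lambda>r. \<xi> r j) has_vector_derivative (A q *v fst (\<xi> r j) + B q *v v r, 0, \<theta>)) (at r)"
    proof
      fix r assume r: "r \<in> {s<..<t} - N"
      then show "\<exists>\<theta>\<in>{0..\<eta>}.
        ((\<lambda>r. \<xi> r j) has_vector_derivative (A q *v fst (\<xi> r j) + B q *v v r, 0, \<theta>)) (at r)"
        using der[OF r] mode[of r] by auto
    qed
  qed
qed

lemma switched_jump:
  assumes sol: "hybrid_solution (switched_system l A B b N0 \<eta>) v E \<xi>"
    and "(t, j) \<in> E" "(t, Suc j) \<in> E"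
  obtains q r y s where "q \<in> {1..l}" "r \<in> {1..l}" "r \<noteq> q" "\<xi> t j = (y, real q, s)" "s \<in> {1..N0}"
    "\<xi> t (Suc j) = (y + matrix_inv (A r) *v b r - matrix_inv (A q) *v b q, real r, s - 1)"
proof -
  have *: "\<xi> t j \<in> jump_set (switched_system l A B b N0 \<eta>)"
    "\<xi> t (Suc j) \<in> jump_map (switched_system l A B b N0 \<eta>) (\<xi> t j) (v t)"
    using assms unfolding hybrid_solution_def by blast+
  obtain y p s where x: "\<xi> t j = (y, p, s)" using prod_cases3 by blast
  show ?thesis using * that unfolding x by (fastforce simp: switched_system_def)
qed

lemma switched_init:
  assumes sol: "hybrid_solution (switched_system l A B b N0 \<eta>) v E \<xi>"
  shows "fst (snd (\<xi> 0 0)) \<in> real ` {1..l}" "snd (snd (\<xi> 0 0)) \<in> {0..N0}"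
proof -
  have "\<xi> 0 0 \<in> flow_set (switched_system l A B b N0 \<eta>) \<union> jump_set (switched_system l A B b N0 \<eta>)"
    using sol closed_switched_flow_set[of l A B b N0 \<eta>] unfolding hybrid_solution_def by simp
  moreover have "jump_set (switched_system l A B b N0 \<eta>) \<subseteq> flow_set (switched_system l A B b N0 \<eta>)"
    by (auto simp: switched_system_def)
  ultimately have "\<xi> 0 0 \<in> flow_set (switched_system l A B b N0 \<eta>)" by blast
  then show "fst (snd (\<xi> 0 0)) \<in> real ` {1..l}" "snd (snd (\<xi> 0 0)) \<in> {0..N0}"
    unfolding mem_switched_flow_set by auto
qed

text \<open>A jump takes the timer from \<open>{1..N0}\<close> to \<open>{0..N0 - 1}\<close>, so
  \<open>infdist_attractor\<close> applies on the whole domain.\<close>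

lemma switched_solution_in_flow_set:
  assumes sol: "hybrid_solution (switched_system l A B b N0 \<eta>) v E \<xi>" and "(t, j) \<in> E"
  shows "fst (snd (\<xi> t j)) \<in> real ` {1..l} \<and> snd (snd (\<xi> t j)) \<in> {0..N0}"
proof -
  have "hybrid_time_domain E" using sol by (simp add: hybrid_solution_def)
  then show ?thesis
    using assms(2)
  proof (induction rule: hybrid_time_domain_induct)
    case init
    then show ?case using switched_init[OF sol] by simp
  next
    case (flow s t j)
    then show ?case
      using hybrid_solution_flow_set[OF sol closed_switched_flow_set flow(1,2), of t]
      unfolding mem_switched_flow_set by simp
  next
    case (jump t j)
    from switched_jump[OF sol jump(1,2)] show ?case
    proof cases
      case (1 q r y s)
      then show ?thesis by auto
    qed
  qed
qed

section \<open>Decay of the weighted Lyapunov function\<close>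

locale switched_lyapunov =
  fixes l :: nat and A :: "nat \<Rightarrow> real^'n^'n" and B :: "nat \<Rightarrow> real^'m^'n" and b :: "nat \<Rightarrow> real^'n"
    and N0 \<eta> a K \<alpha> \<beta> c :: real and P :: "nat \<Rightarrow> real^'n \<Rightarrow> real^'n \<Rightarrow> real"
  assumes N0: "N0 \<ge> 1" and eta: "\<eta> \<ge> 0" and a: "a > 0" and K: "K \<ge> 1"
    and alpha: "\<alpha> \<ge> 0" and beta: "\<beta> \<ge> 0" and c: "c \<ge> 0"
    and P_bilinear: "\<And>q. q \<in> {1..l} \<Longrightarrow> bounded_bilinear (P q)"
    and P_commute: "\<And>q x y. q \<in> {1..l} \<Longrightarrow> P q x y = P q y x"
    and P_ge: "\<And>q x. q \<in> {1..l} \<Longrightarrow> (norm x)\<^sup>2 \<le> P q x x"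
    and P_le: "\<And>q x y. q \<in> {1..l} \<Longrightarrow> \<bar>P q x y\<bar> \<le> K * norm x * norm y"
    and P_dissipative: "\<And>q x. q \<in> {1..l} \<Longrightarrow> P q x (A q *v x) \<le> - a * P q x x"
    and A_le: "\<And>q x. q \<in> {1..l} \<Longrightarrow> norm (A q *v x) \<le> \<alpha> * norm x"
    and B_le: "\<And>q w. q \<in> {1..l} \<Longrightarrow> norm (B q *v w) \<le> \<beta> * norm w"
    and jump_le: "\<And>q r. q \<in> {1..l} \<Longrightarrow> r \<in> {1..l} \<Longrightarrow> r \<noteq> q \<Longrightarrow>
      norm (matrix_inv (A r) *v b r - matrix_inv (A q) *v b q) \<le> c"
    and dwell: "ln (4 * K) * \<eta> < a"
begin

abbreviation "H \<equiv> switched_system l A B b N0 \<eta>"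
text \<open>Lowering the timer by 1 divides the weight by \<open>4 * K\<close>. The assumption
  \<open>dwell\<close> reads \<open>L * \<eta> < a\<close>, an average dwell-time condition.\<close>

definition "L = ln (4 * K)"
text \<open>The first entry is the decay rate left during flow. The second accounts for jumps, which
  halve the function while \<open>t + j\<close> advances by 1.\<close>

definition "\<kappa> = min (a - L * \<eta>) (ln 2)"
text \<open>The source term of the differential inequality for \<open>lyap\<close>, taken at the
  largest possible weight.\<close>

definition "gain U = exp (L * N0) * (K\<^sup>2 * \<beta>\<^sup>2 / a * U\<^sup>2)"
text \<open>The floor recovers the mode index from its embedding in the reals.\<close>

definition "lyap x = exp (L * snd (snd x)) * P (nat \<lfloor>fst (snd x)\<rfloor>) (fst x) (fst x)"
  for x :: "'n switched_state"

lemma L_nonneg: "L \<ge> 0" and exp_L: "exp L = 4 * K"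
  using K by (auto simp: L_def)

lemma kappa: "\<kappa> > 0" "\<kappa> \<le> a - L * \<eta>" "\<kappa> \<le> ln 2"
  using dwell by (auto simp: \<kappa>_def L_def)

lemma P_nonneg: "q \<in> {1..l} \<Longrightarrow> 0 \<le> P q x x"
  by (rule order_trans[OF zero_le_power2 P_ge])

lemma gain_nonneg: "gain U \<ge> 0"
  using a by (simp add: gain_def)

text \<open>Half of the dissipation \<open>2 * a\<close> is given up to absorb the input: by Young's
  inequality \<open>2 * K * norm y * \<beta> * U\<close> is at most \<open>a * (norm y)^2\<close>
  plus the stated constant.\<close>

lemma lyapunov_derivative_bound:
  assumes q: "q \<in> {1..l}" and w: "norm w \<le> U"
  shows "2 * P q y (A q *v y + B q *v w) \<le> - a * P q y y + K\<^sup>2 * \<beta>\<^sup>2 / a * U\<^sup>2"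
proof -
  interpret bounded_bilinear "P q" using P_bilinear[OF q] .
  have "norm (B q *v w) \<le> \<beta> * U"
    using B_le[OF q, of w] w beta by (meson mult_left_mono order_trans)
  then have "K * norm y * norm (B q *v w) \<le> K * norm y * (\<beta> * U)"
    using K by (intro mult_left_mono) auto
  then have 1: "P q y (B q *v w) \<le> K * norm y * (\<beta> * U)"
    using P_le[OF q, of y "B q *v w"] by linarith
  have "0 \<le> (a * norm y - K * \<beta> * U)\<^sup>2" by simp
  then have "2 * (K * norm y * (\<beta> * U)) * a \<le> a\<^sup>2 * (norm y)\<^sup>2 + K\<^sup>2 * \<beta>\<^sup>2 * U\<^sup>2"
    by (simp add: power2_eq_square algebra_simps)
  then have "2 * (K * norm y * (\<beta> * U)) \<le> (a\<^sup>2 * (norm y)\<^sup>2 + K\<^sup>2 * \<beta>\<^sup>2 * U\<^sup>2) / a"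
    using a by (simp add: pos_le_divide_eq)
  also have "\<dots> = a * (norm y)\<^sup>2 + K\<^sup>2 * \<beta>\<^sup>2 / a * U\<^sup>2"
    using a by (simp add: field_simps power2_eq_square)
  also have "\<dots> \<le> a * P q y y + K\<^sup>2 * \<beta>\<^sup>2 / a * U\<^sup>2"
    using P_ge[OF q, of y] a by simp
  finally show ?thesis using 1 P_dissipative[OF q, of y] by (simp add: add_right)
qed

lemma lyap_flow:
  assumes sol: "hybrid_solution H v E \<xi>" and v: "\<And>t. t \<ge> 0 \<Longrightarrow> norm (v t) \<le> U"
    and st: "s < t" "{s..t} \<times> {j} \<subseteq> E"
  shows "lyap (\<xi> t j) - gain U / \<kappa> \<le> exp (- \<kappa> * (t - s)) * (lyap (\<xi> s j) - gain U / \<kappa>)"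
proof -
  obtain q N where q: "q \<in> {1..l}" and ac: "abs_continuous_on {s..t} (\<lambda>r. \<xi> r j)" and N: "negligible N"
    and mem': "\<forall>r\<in>{s..t}. fst (snd (\<xi> r j)) = real q \<and> snd (snd (\<xi> r j)) \<in> {0..N0}"
    and der: "\<forall>r\<in>{s<..<t} - N. \<exists>\<theta>\<in>{0..\<eta>}.
      ((\<lambda>r. \<xi> r j) has_vector_derivative (A q *v fst (\<xi> r j) + B q *v v r, 0, \<theta>)) (at r)"
    by (rule switched_flow[OF sol st]) (rule that)
  note mem = bspec[OF mem']
  have s0: "s \<ge> 0"
  proof (rule hybrid_time_domain_nonneg)
    show "hybrid_time_domain E" using sol by (simp add: hybrid_solution_def)
    show "(s, j) \<in> E" using st by auto
  qed
  define y where "y r = fst (\<xi> r j)" for r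
  define z where "z r = snd (snd (\<xi> r j))" for r
  define f where "f r = exp (L * z r) * P q (y r) (y r)" for r
  have lyap_f: "lyap (\<xi> r j) = f r" if "r \<in> {s..t}" for r
    using mem[OF that] by (simp add: lyap_def f_def y_def z_def)
  have bd: "bounded (h ` {s..t})" if "abs_continuous_on {s..t} h" for h :: "real \<Rightarrow> 'x::real_normed_vector"
    using that by (intro compact_imp_bounded compact_continuous_image abs_continuous_on_imp_continuous_on) auto
  have y: "abs_continuous_on {s..t} y"
    unfolding y_def by (rule abs_continuous_on_bounded_linear[OF bounded_linear_fst ac])
  have z: "abs_continuous_on {s..t} z"
    unfolding z_def by (rule abs_continuous_on_bounded_linear[OF bounded_linear_snd_snd ac])
  \<comment> \<open>The timer never exceeds \<open>N0\<close>, and there the exponential weight is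
    Lipschitz.\<close>
  have 1: "abs_continuous_on {s..t} (\<lambda>r. exp (L * z r))"
  proof (rule abs_continuous_on_compose_lipschitz[OF z, of "\<lambda>x. exp (L * x)" "exp (L * N0) * L"])
    fix r r' assume "r \<in> {s..t}" "r' \<in> {s..t}"
    then have "\<bar>exp (L * z r) - exp (L * z r')\<bar> \<le> exp (L * N0) * \<bar>L * z r - L * z r'\<bar>"
      using mem L_nonneg by (intro exp_lipschitz_atMost mult_left_mono) (auto simp: z_def)
    then show "norm (exp (L * z r) - exp (L * z r')) \<le> exp (L * N0) * L * norm (z r - z r')"
      using L_nonneg by (simp add: right_diff_distrib[symmetric] abs_mult mult.assoc)
  qed
  have 2: "abs_continuous_on {s..t} (\<lambda>r. P q (y r) (y r))"
    by (rule abs_continuous_on_bilinear[OF P_bilinear[OF q] y bd[OF y] y bd[OF y]])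
  have 3: "abs_continuous_on {s..t} f"
    unfolding f_def by (rule abs_continuous_on_bilinear[OF bounded_bilinear_mult 1 bd[OF 1] 2 bd[OF 2]])
  have "f t - gain U / \<kappa> \<le> exp (- \<kappa> * (t - s)) * (f s - gain U / \<kappa>)"
  proof (rule abs_continuous_on_gronwall[OF _ kappa(1) 3 N])
    fix r assume r: "r \<in> {s<..<t} - N"
    then obtain \<theta> where \<theta>: "\<theta> \<in> {0..\<eta>}"
      and d: "((\<lambda>r. \<xi> r j) has_vector_derivative (A q *v y r + B q *v v r, 0, \<theta>)) (at r)"
      using der unfolding y_def by blast
    let ?y' = "A q *v y r + B q *v v r"
    let ?V = "P q (y r) (y r)"
    have dy: "(y has_vector_derivative ?y') (at r)"
      using bounded_linear.has_vector_derivative[OF bounded_linear_fst d] by (simp add: y_def[abs_def])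
    have "(z has_vector_derivative \<theta>) (at r)"
      using bounded_linear.has_vector_derivative[OF bounded_linear_snd_snd d] by (simp add: z_def[abs_def])
    then have dz: "(z has_real_derivative \<theta>) (at r)"
      by (simp add: has_real_derivative_iff_has_vector_derivative)
    have "((\<lambda>r. P q (y r) (y r)) has_vector_derivative P q (y r) ?y' + P q ?y' (y r)) (at r)"
      by (rule bounded_bilinear.has_vector_derivative[OF P_bilinear[OF q] dy dy])
    then have dV: "((\<lambda>r. P q (y r) (y r)) has_real_derivative 2 * P q (y r) ?y') (at r)"
      using P_commute[OF q, of ?y' "y r"] by (simp add: has_real_derivative_iff_has_vector_derivative)
    have df: "(f has_vector_derivative exp (L * z r) * (L * \<theta> * ?V + 2 * P q (y r) ?y')) (at r)"
      unfolding f_def has_real_derivative_iff_has_vector_derivative[symmetric]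
      by (auto intro!: derivative_eq_intros dz dV simp: algebra_simps)
    have rr: "r \<in> {s..t}" using r by auto
    have "exp (L * z r) \<le> exp (L * N0)"
      using mem[OF rr] L_nonneg by (simp add: z_def mult_left_mono)
    then have "exp (L * z r) * (K\<^sup>2 * \<beta>\<^sup>2 / a * U\<^sup>2) \<le> gain U"
      unfolding gain_def using a by (intro mult_right_mono) auto
    moreover have "L * \<theta> * ?V + 2 * P q (y r) ?y' \<le> - \<kappa> * ?V + K\<^sup>2 * \<beta>\<^sup>2 / a * U\<^sup>2"
    proof -
      \<comment> \<open>The relative growth of the weight is at most \<open>L * \<eta>\<close>; the
        rate \<open>\<kappa>\<close> is what remains of \<open>a\<close>.\<close>
      have "L * \<theta> * ?V \<le> (a - \<kappa>) * ?V"
      proof (rule mult_right_mono)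
        have "L * \<theta> \<le> L * \<eta>" using \<theta> L_nonneg by (intro mult_left_mono) auto
        then show "L * \<theta> \<le> a - \<kappa>" using kappa(2) by linarith
      qed (rule P_nonneg[OF q])
      moreover have "2 * P q (y r) ?y' \<le> - a * ?V + K\<^sup>2 * \<beta>\<^sup>2 / a * U\<^sup>2"
        by (rule lyapunov_derivative_bound[OF q v]) (use r s0 in auto)
      ultimately show ?thesis by (simp add: algebra_simps)
    qed
    then have "exp (L * z r) * (L * \<theta> * ?V + 2 * P q (y r) ?y') \<le>
        exp (L * z r) * (- \<kappa> * ?V + K\<^sup>2 * \<beta>\<^sup>2 / a * U\<^sup>2)"
      by (intro mult_left_mono) auto
    ultimately have "exp (L * z r) * (L * \<theta> * ?V + 2 * P q (y r) ?y') \<le> - \<kappa> * f r + gain U"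
      by (simp add: f_def algebra_simps)
    then show "\<exists>D. D \<le> - \<kappa> * f r + gain U \<and> (f has_vector_derivative D) (at r)"
      using df by blast
  qed (use st in simp)
  then show ?thesis using lyap_f st(1) by simp
qed

text \<open>Three factors meet: squaring the triangle inequality costs 2, passing to the form of the
  new mode costs \<open>K\<close>, and the timer step gains \<open>exp L = 4 * K\<close>. The net
  factor is 1/2.\<close>

lemma lyap_jump:
  assumes sol: "hybrid_solution H v E \<xi>" and tj: "(t, j) \<in> E" "(t, Suc j) \<in> E"
  shows "lyap (\<xi> t (Suc j)) \<le> lyap (\<xi> t j) / 2 + exp (L * N0) * c\<^sup>2 / 2"
proof -
  obtain q r y s where q: "q \<in> {1..l}" "r \<in> {1..l}" "r \<noteq> q" and s: "s \<in> {1..N0}"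
    and x: "\<xi> t j = (y, real q, s)"
    "\<xi> t (Suc j) = (y + matrix_inv (A r) *v b r - matrix_inv (A q) *v b q, real r, s - 1)"
    by (rule switched_jump[OF sol tj]) (rule that)
  define y' where "y' = y + matrix_inv (A r) *v b r - matrix_inv (A q) *v b q"
  have "norm y' \<le> norm y + norm (matrix_inv (A r) *v b r - matrix_inv (A q) *v b q)"
    unfolding y'_def by (metis add_diff_eq norm_triangle_ineq)
  also have "\<dots> \<le> norm y + c" using jump_le[OF q] by simp
  finally have "(norm y')\<^sup>2 \<le> (norm y + c)\<^sup>2" by (intro power_mono) auto
  also have "\<dots> \<le> 2 * (norm y)\<^sup>2 + 2 * c\<^sup>2"
    using zero_le_power2[of "norm y - c"] by (simp add: power2_eq_square algebra_simps)
  also have "\<dots> \<le> 2 * P q y y + 2 * c\<^sup>2" using P_ge[OF q(1), of y] by simp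
  finally have y': "(norm y')\<^sup>2 \<le> 2 * P q y y + 2 * c\<^sup>2" .
  have e: "exp (L * (s - 1)) = exp (L * s) / (4 * K)"
    by (simp add: right_diff_distrib exp_diff exp_L)
  have "lyap (\<xi> t (Suc j)) = exp (L * s) / (4 * K) * P r y' y'"
    by (simp add: x lyap_def y'_def e)
  also have "\<dots> \<le> exp (L * s) / (4 * K) * (K * (norm y')\<^sup>2)"
    using P_le[OF q(2), of y' y'] K by (intro mult_left_mono) (auto simp: power2_eq_square)
  also have "\<dots> = exp (L * s) / 4 * (norm y')\<^sup>2" using K by simp
  also have "\<dots> \<le> exp (L * s) / 4 * (2 * P q y y + 2 * c\<^sup>2)" using y' by (intro mult_left_mono) auto
  also have "\<dots> = lyap (\<xi> t j) / 2 + exp (L * s) * c\<^sup>2 / 2"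
    by (simp add: x lyap_def algebra_simps)
  also have "\<dots> \<le> lyap (\<xi> t j) / 2 + exp (L * N0) * c\<^sup>2 / 2"
    using s L_nonneg by (simp add: mult_left_mono mult_right_mono)
  finally show ?thesis .
qed

text \<open>A level that neither kind of step pushes upwards: it lies above the equilibrium
  \<open>gain U / \<kappa>\<close> of the flow estimate and above the fixed point
  \<open>exp (L * N0) * c^2\<close> of the jump estimate.\<close>

definition "offset U = gain U / \<kappa> + exp (L * N0) * c\<^sup>2"

lemma lyap_nonneg:
  assumes "fst (snd x) \<in> real ` {1..l}"
  shows "0 \<le> lyap x"
  using assms P_nonneg by (auto simp: lyap_def)

text \<open>The decaying initial term and the offset are propagated separately, so the offset does
  not grow with the number of flows and jumps.\<close>

lemma lyap_bound:
  assumes sol: "hybrid_solution H v E \<xi>" and v: "\<And>t. t \<ge> 0 \<Longrightarrow> norm (v t) \<le> U"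
    and tj: "(t, j) \<in> E"
  shows "lyap (\<xi> t j) \<le> exp (- \<kappa> * (t + real j)) * lyap (\<xi> 0 0) + offset U"
proof -
  have off: "offset U \<ge> gain U / \<kappa>" "offset U \<ge> exp (L * N0) * c\<^sup>2"
    using gain_nonneg[of U] kappa(1) by (auto simp: offset_def)
  then have off0: "0 \<le> offset U" by (meson exp_ge_zero mult_nonneg_nonneg order_trans zero_le_power2)
  have "hybrid_time_domain E" using sol by (simp add: hybrid_solution_def)
  then show ?thesis
    using tj
  proof (induction rule: hybrid_time_domain_induct)
    case init
    then show ?case using off0 by simp
  next
    case (flow s t j)
    let ?e = "exp (- \<kappa> * (t - s))"
    have e1: "?e \<le> 1" using kappa(1) flow(1) by simp
    have "lyap (\<xi> t j) - gain U / \<kappa> \<le> ?e * (lyap (\<xi> s j) - gain U / \<kappa>)"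
      by (rule lyap_flow[OF sol v flow(1,2)])
    also have "\<dots> \<le> ?e * (exp (- \<kappa> * (s + real j)) * lyap (\<xi> 0 0) + (offset U - gain U / \<kappa>))"
      using flow(3) by (intro mult_left_mono) auto
    also have "\<dots> = exp (- \<kappa> * (t + real j)) * lyap (\<xi> 0 0) + ?e * (offset U - gain U / \<kappa>)"
      by (simp add: distrib_left mult.assoc[symmetric] exp_add[symmetric]) (simp add: algebra_simps)
    also have "?e * (offset U - gain U / \<kappa>) \<le> 1 * (offset U - gain U / \<kappa>)"
      using off(1) e1 by (intro mult_right_mono) auto
    finally show ?case by simp
  next
    case (jump t j)
    have l0: "0 \<le> lyap (\<xi> 0 0)" using switched_init(1)[OF sol] by (rule lyap_nonneg)
    have "exp (- ln 2) \<le> exp (- \<kappa>)" using kappa(3) by simp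
    then have half: "1 / 2 \<le> exp (- \<kappa>)" by (simp add: exp_minus)
    have "lyap (\<xi> t (Suc j)) \<le> lyap (\<xi> t j) / 2 + exp (L * N0) * c\<^sup>2 / 2"
      by (rule lyap_jump[OF sol jump(1,2)])
    also have "\<dots> \<le> 1 / 2 * (exp (- \<kappa> * (t + real j)) * lyap (\<xi> 0 0)) + offset U"
      using jump(3) off(2) by simp
    also have "1 / 2 * (exp (- \<kappa> * (t + real j)) * lyap (\<xi> 0 0))
        \<le> exp (- \<kappa>) * (exp (- \<kappa> * (t + real j)) * lyap (\<xi> 0 0))"
      using half l0 by (intro mult_right_mono) auto
    also have "\<dots> = exp (- \<kappa> * (t + real (Suc j))) * lyap (\<xi> 0 0)"
      by (simp add: mult.assoc[symmetric] exp_add[symmetric]) (simp add: algebra_simps)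
    finally show ?case by simp
  qed
qed

text \<open>Taking square roots halves the rate and turns the quadratic dependence on
  \<open>U\<close> and \<open>c\<close> into a linear one. \<open>G\<close> and \<open>R\<close> do
  not mention \<open>U\<close>, so the gains are uniform in the input.\<close>

lemma norm_bound:
  assumes sol: "hybrid_solution H v E \<xi>" and v: "\<And>t. t \<ge> 0 \<Longrightarrow> norm (v t) \<le> U"
    and tj: "(t, j) \<in> E"
  defines "G \<equiv> exp (L * N0) * K" and "R \<equiv> exp (L * N0) * (K\<^sup>2 * \<beta>\<^sup>2 / (a * \<kappa>) + 1)"
  shows "norm (fst (\<xi> t j)) \<le> sqrt G * exp (- (\<kappa> / 2) * (t + real j)) * norm (fst (\<xi> 0 0)) + sqrt R * (U + c)"
proof -
  have U: "U \<ge> 0" using order_trans[OF norm_ge_zero v[of 0]] by simp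
  have G: "G \<ge> 0" using K by (simp add: G_def)
  have R: "R \<ge> 0" using a kappa(1) by (simp add: R_def)
  obtain q where q: "q \<in> {1..l}" "fst (snd (\<xi> t j)) = real q" and zt: "snd (snd (\<xi> t j)) \<ge> 0"
    using switched_solution_in_flow_set[OF sol tj] by auto
  obtain q0 where q0: "q0 \<in> {1..l}" "fst (snd (\<xi> 0 0)) = real q0" and z0: "snd (snd (\<xi> 0 0)) \<le> N0"
    using switched_init[OF sol] by auto
  \<comment> \<open>The factor 1 is compared with the weight, which is at least 1 because the timer
    is nonnegative.\<close>
  have "(norm (fst (\<xi> t j)))\<^sup>2 \<le> 1 * P q (fst (\<xi> t j)) (fst (\<xi> t j))"
    using P_ge[OF q(1)] by simp
  also have "\<dots> \<le> lyap (\<xi> t j)"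
    unfolding lyap_def using q zt L_nonneg P_nonneg by (intro mult_mono) auto
  also have "\<dots> \<le> exp (- \<kappa> * (t + real j)) * lyap (\<xi> 0 0) + offset U"
    by (rule lyap_bound[OF sol v tj])
  also have "lyap (\<xi> 0 0) \<le> exp (L * N0) * (K * (norm (fst (\<xi> 0 0)))\<^sup>2)"
    unfolding lyap_def using q0 z0 L_nonneg P_nonneg P_le[OF q0(1), of "fst (\<xi> 0 0)" "fst (\<xi> 0 0)"]
    by (intro mult_mono) (auto simp: power2_eq_square mult_left_mono mult.assoc)
  also have "offset U \<le> R * (U\<^sup>2 + c\<^sup>2)"
  proof -
    define X where "X = exp (L * N0) * (K\<^sup>2 * \<beta>\<^sup>2 / (a * \<kappa>))"
    have X: "0 \<le> X" using a kappa(1) by (simp add: X_def)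
    have "offset U = X * U\<^sup>2 + exp (L * N0) * c\<^sup>2"
      by (simp add: offset_def gain_def X_def)
    moreover have "R = X + exp (L * N0)" by (simp add: R_def X_def distrib_left)
    ultimately show ?thesis using X by (simp add: algebra_simps)
  qed
  finally have "(norm (fst (\<xi> t j)))\<^sup>2 \<le>
      exp (- \<kappa> * (t + real j)) * (exp (L * N0) * (K * (norm (fst (\<xi> 0 0)))\<^sup>2)) + R * (U\<^sup>2 + c\<^sup>2)"
    by simp
  also have "\<dots> \<le> (sqrt G * exp (- (\<kappa> / 2) * (t + real j)) * norm (fst (\<xi> 0 0)))\<^sup>2 + (sqrt R * (U + c))\<^sup>2"
  proof (rule add_mono)
    have "exp (- \<kappa> * (t + real j)) = (exp (- (\<kappa> / 2) * (t + real j)))\<^sup>2"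
      by (simp add: exp_double[symmetric])
    then show "exp (- \<kappa> * (t + real j)) * (exp (L * N0) * (K * (norm (fst (\<xi> 0 0)))\<^sup>2))
      \<le> (sqrt G * exp (- (\<kappa> / 2) * (t + real j)) * norm (fst (\<xi> 0 0)))\<^sup>2"
      using G by (simp add: power_mult_distrib) (simp add: G_def mult_ac)
    have "U\<^sup>2 + c\<^sup>2 \<le> (U + c)\<^sup>2" using U c by (simp add: power2_sum)
    then show "R * (U\<^sup>2 + c\<^sup>2) \<le> (sqrt R * (U + c))\<^sup>2"
      using R by (simp add: power_mult_distrib mult_left_mono)
  qed
  also have "\<dots> \<le> (sqrt G * exp (- (\<kappa> / 2) * (t + real j)) * norm (fst (\<xi> 0 0)) + sqrt R * (U + c))\<^sup>2"
    using G R U c by (simp add: power2_sum)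
  finally show ?thesis
    by (rule power2_le_imp_le) (use G R U c in auto)
qed

end

section \<open>Completeness of maximal solutions\<close>

lemma lipschitz_on_extend_closure:
  fixes f :: "'a::metric_space \<Rightarrow> 'b::complete_space"
  assumes f: "C-lipschitz_on S f"
  obtains g where "C-lipschitz_on (closure S) g" "\<forall>s\<in>S. g s = f s"
proof (rule uniformly_continuous_on_extension_on_closure[OF lipschitz_on_uniformly_continuous[OF f]])
  fix g assume g: "uniformly_continuous_on (closure S) g" "\<And>x. x \<in> S \<Longrightarrow> f x = g x"
  have "C-lipschitz_on S g" by (rule lipschitz_on_transform[OF f]) (simp add: g(2))
  then have "C-lipschitz_on (closure S) g"
    by (rule lipschitz_on_closure) (rule uniformly_continuous_imp_continuous[OF g(1)])
  then show thesis by (rule that) (simp add: g(2))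
qed

context switched_lyapunov
begin

lemma flow_velocity_bound:
  assumes x: "norm (fst x) \<le> Y" and w: "norm w \<le> U" and d: "d \<in> flow_map H x w"
  shows "norm d \<le> \<alpha> * Y + \<beta> * U + \<eta>"
proof -
  obtain y p s where xx: "x = (y, p, s)" using prod_cases3 by blast
  obtain q \<theta> where q: "q \<in> {1..l}" and \<theta>: "\<theta> \<in> {0..\<eta>}" and dd: "d = (A q *v y + B q *v w, 0, \<theta>)"
    using d unfolding xx by (auto simp: switched_system_def)
  have "norm d \<le> norm (A q *v y + B q *v w) + norm (0::real, \<theta>)"
    unfolding dd by (rule norm_Pair_le)
  also have "norm (0::real, \<theta>) \<le> \<eta>" using \<theta> by (simp add: norm_Pair)
  also have "norm (A q *v y + B q *v w) \<le> \<alpha> * norm y + \<beta> * norm w"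
    by (rule order_trans[OF norm_triangle_ineq add_mono[OF A_le[OF q] B_le[OF q]]])
  also have "\<dots> \<le> \<alpha> * Y + \<beta> * U"
    using x w alpha beta by (intro add_mono mult_left_mono) (auto simp: xx)
  finally show ?thesis by simp
qed

text \<open>A bounded state and input give a bounded velocity. \<open>I\<close> is a general
  interval because both the half-open last interval and its closed version are needed.\<close>

lemma flow_lipschitz:
  assumes sol: "hybrid_solution H v E \<xi>" and v: "\<And>t. t \<ge> 0 \<Longrightarrow> norm (v t) \<le> U"
    and Y: "\<And>t j. (t, j) \<in> E \<Longrightarrow> norm (fst (\<xi> t j)) \<le> Y"
    and I: "I \<times> {j} \<subseteq> E" and conv: "\<And>s t. s \<in> I \<Longrightarrow> t \<in> I \<Longrightarrow> {s..t} \<subseteq> I"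
  shows "(\<alpha> * Y + \<beta> * U + \<eta>)-lipschitz_on I (\<lambda>s. \<xi> s j)"
proof -
  have htd: "hybrid_time_domain E" using sol by (simp add: hybrid_solution_def)
  have "0 \<le> U" using order_trans[OF norm_ge_zero v[of 0]] by simp
  moreover have "0 \<le> Y" using order_trans[OF norm_ge_zero Y[OF hybrid_time_domain_zero[OF htd]]] .
  ultimately have M: "0 \<le> \<alpha> * Y + \<beta> * U + \<eta>" using alpha beta eta by simp
  have "norm (\<xi> t j - \<xi> s j) \<le> (\<alpha> * Y + \<beta> * U + \<eta>) * (t - s)"
    if st: "s \<in> I" "t \<in> I" "s \<le> t" for s t
  proof -
    have sub: "{s..t} \<times> {j} \<subseteq> E" using conv[OF st(1,2)] I by blast
    then have "{s<..<t} \<times> {j} \<subseteq> E" by auto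
    then obtain N where N: "negligible N" "\<forall>r\<in>{s<..<t} - N.
        \<exists>d\<in>flow_map H (\<xi> r j) (v r). ((\<lambda>r. \<xi> r j) has_vector_derivative d) (at r)"
      by (rule hybrid_solution_flow[OF sol]) (rule that)
    show ?thesis
    proof (rule abs_continuous_on_norm_le[OF st(3) M hybrid_solution_abs_continuous[OF sol sub] N(1)])
      fix r assume r: "r \<in> {s<..<t} - N"
      then obtain d where d: "d \<in> flow_map H (\<xi> r j) (v r)"
        "((\<lambda>r. \<xi> r j) has_vector_derivative d) (at r)"
        using N(2) by blast
      have rE: "(r, j) \<in> E" using r sub by auto
      have "norm d \<le> \<alpha> * Y + \<beta> * U + \<eta>"
        by (rule flow_velocity_bound[OF Y[OF rE] v d(1)]) (rule hybrid_time_domain_nonneg[OF htd rE])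
      then show "\<exists>d. norm d \<le> \<alpha> * Y + \<beta> * U + \<eta> \<and> ((\<lambda>r. \<xi> r j) has_vector_derivative d) (at r)"
        using d(2) by blast
    qed
  qed note * = this
  show ?thesis
  proof (rule lipschitz_onI[OF _ M])
    fix s t assume "s \<in> I" "t \<in> I"
    then show "dist (\<xi> s j) (\<xi> t j) \<le> (\<alpha> * Y + \<beta> * U + \<eta>) * dist s t"
      using *[of s t] *[of t s] by (cases "s \<le> t") (auto simp: dist_norm norm_minus_commute)
  qed
qed

text \<open>Continuation is never blocked: the flow set does not restrict the continuous state, and
  timer speed 0 is always admissible, even with the timer at \<open>N0\<close>. Continuity of the
  input makes the continued arc differentiable.\<close>

lemma maximal_solution_complete:
  assumes max: "maximal_hybrid_solution H v E \<xi>" and v: "\<And>t. t \<ge> 0 \<Longrightarrow> norm (v t) \<le> U"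
    and cont: "continuous_on {0..} v"
  shows "complete_time_domain E"
proof (rule ccontr)
  assume inc: "\<not> complete_time_domain E"
  have sol: "hybrid_solution H v E \<xi>" using max by (simp add: maximal_hybrid_solution_def)
  then have htd: "hybrid_time_domain E" by (simp add: hybrid_solution_def)
  obtain J t T where dom: "t 0 = 0" "\<And>j. j < J \<Longrightarrow> t j \<le> t (Suc j)" "t J \<le> T" "(t J, J) \<in> E"
    "\<And>s j. j < J \<Longrightarrow> (s, j) \<in> E \<longleftrightarrow> t j \<le> s \<and> s \<le> t (Suc j)"
    "\<And>s. (s, J) \<in> E \<Longrightarrow> t J \<le> s \<and> s \<le> T" "\<And>s. t J \<le> s \<Longrightarrow> s < T \<Longrightarrow> (s, J) \<in> E"
    "\<And>s j. J < j \<Longrightarrow> (s, j) \<notin> E"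
    by (rule incomplete_hybrid_time_domain[OF htd inc]) (rule that; blast)
  obtain Y where Y: "\<And>t j. (t, j) \<in> E \<Longrightarrow> norm (fst (\<xi> t j)) \<le> Y"
  proof
    fix t j assume tj: "(t, j) \<in> E"
    let ?G = "sqrt (exp (L * N0) * K)"
    have "exp (- (\<kappa> / 2) * (t + real j)) \<le> 1"
      using kappa(1) hybrid_time_domain_nonneg[OF htd tj] by simp
    then have "?G * exp (- (\<kappa> / 2) * (t + real j)) * norm (fst (\<xi> 0 0)) \<le> ?G * 1 * norm (fst (\<xi> 0 0))"
      using K by (intro mult_right_mono mult_left_mono) auto
    then show "norm (fst (\<xi> t j)) \<le> ?G * 1 * norm (fst (\<xi> 0 0))
        + sqrt (exp (L * N0) * (K\<^sup>2 * \<beta>\<^sup>2 / (a * \<kappa>) + 1)) * (U + c)"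
      using norm_bound[OF sol v tj] by linarith
  qed
  define M where "M = \<alpha> * Y + \<beta> * U + \<eta>"
  \<comment> \<open>Both contradictions below have this shape, first with \<open>T' = T\<close> to
    close the last interval, then with \<open>T' = T + h\<close> to flow beyond it.\<close>
  have no_extension: False
    if T': "T \<le> T'" "(T', J) \<notin> E" and g: "\<And>s. (s, J) \<in> E \<Longrightarrow> g s = \<xi> s J"
      "C-lipschitz_on {t J..T'} g" "\<And>s. s \<in> {t J<..<T'} \<Longrightarrow> g s \<in> flow_set H"
      "negligible N"
      "\<And>s. s \<in> {t J<..<T'} - N \<Longrightarrow> \<exists>w\<in>flow_map H (g s) (v s). (g has_vector_derivative w) (at s)"
    for T' g N C
  proof -
    have tT: "t J \<le> T'" using dom(3) T' by simp
    have ac: "abs_continuous_on {t J..T'} g"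
      using lipschitz_on_normD[OF g(2)] by (rule lipschitz_imp_abs_continuous_on)
    have dom6: "t J \<le> s \<and> s \<le> T'" if "(s, J) \<in> E" for s using dom(6)[OF that] T' by simp
    have eq: "E \<union> {t J..T'} \<times> {J} = E"
    proof (rule maximal_hybrid_solution_no_extension[OF max])
      show "hybrid_solution H v (E \<union> {t J..T'} \<times> {J}) (\<lambda>s j. if j = J then g s else \<xi> s j)"
        by (rule hybrid_solution_extend(1)[OF sol dom(1,2) tT dom(4,5) dom6 dom(8) g(1) ac g(3-5)])
    qed (use g(1) in auto)
    have "(T', J) \<in> E \<union> {t J..T'} \<times> {J}" using tT by simp
    then show False unfolding eq using T'(2) by contradiction
  qed
  have "{t J<..<T} \<times> {J} \<subseteq> E" using dom(7) by auto
  then obtain N where N: "negligible N" "\<forall>r\<in>{t J<..<T}. \<xi> r J \<in> flow_set H" "\<forall>r\<in>{t J<..<T} - N.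
        \<exists>d\<in>flow_map H (\<xi> r J) (v r). ((\<lambda>r. \<xi> r J) has_vector_derivative d) (at r)"
    by (rule hybrid_solution_flow[OF sol]) (rule that)
  have TE: "(T, J) \<in> E"
  proof (rule ccontr)
    assume T: "(T, J) \<notin> E"
    then have tT: "t J < T" using dom(3,4) by (cases "t J = T") auto
    let ?I = "{t J..<T}"
    have lip: "M-lipschitz_on ?I (\<lambda>s. \<xi> s J)"
      unfolding M_def by (rule flow_lipschitz[OF sol v Y]) (use dom(7) in auto)
    \<comment> \<open>The limit at \<open>T\<close> comes from completeness of the state space; the
      Lipschitz constant survives, so the closed arc is again absolutely continuous.\<close>
    obtain g where g: "M-lipschitz_on (closure ?I) g" "\<forall>s\<in>?I. g s = \<xi> s J"
      by (rule lipschitz_on_extend_closure[OF lip]) (rule that)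
    have gE: "g s = \<xi> s J" if "(s, J) \<in> E" for s
    proof -
      have "s \<noteq> T" using that T by auto
      then show ?thesis using g(2) dom(6)[OF that] by auto
    qed
    have glip: "M-lipschitz_on {t J..T} g" using g(1) tT by simp
    show False
    proof (rule no_extension[OF order_refl T gE glip _ N(1)])
      show "g s \<in> flow_set H" if "s \<in> {t J<..<T}" for s
        using N(2) that g(2) by auto
      show "\<exists>w\<in>flow_map H (g s) (v s). (g has_vector_derivative w) (at s)"
        if s: "s \<in> {t J<..<T} - N" for s
      proof -
        have eq: "\<xi> s J = g s" using g(2) s by auto
        obtain d where d: "d \<in> flow_map H (\<xi> s J) (v s)" "((\<lambda>r. \<xi> r J) has_vector_derivative d) (at s)"
          using N(3) s by blast
        have "(g has_vector_derivative d) (at s)"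
          by (rule has_vector_derivative_transform_within_open[OF d(2), of "{t J<..<T}"]) (use s g(2) in auto)
        then show ?thesis using d(1) eq by auto
      qed
    qed
  qed
  obtain y0 p z where xT: "\<xi> T J = (y0, p, z)" using prod_cases3 by blast
  obtain q where q: "q \<in> {1..l}" "p = real q" and z: "z \<in> {0..N0}"
    using switched_solution_in_flow_set[OF sol TE] by (auto simp: xT)
  have T0: "0 \<le> T" by (rule hybrid_time_domain_nonneg[OF htd TE])
  have "continuous_on {T..} v" by (rule continuous_on_subset[OF cont]) (use T0 in auto)
  then have wc: "continuous_on {T..} (\<lambda>r. B q *v v r)"
    by (rule linear_continuous_on_compose[OF _ matrix_vector_mul_linear])
  obtain h y where h: "h > 0" and yT: "y T = y0" and yc: "continuous_on {T..T + h} y"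
    and yd: "\<forall>r\<in>{T..T + h}. (y has_vector_derivative A q *v y r + B q *v v r) (at r within {T..T + h})"
    by (rule linear_ode_local_solution[OF matrix_vector_mul_bounded_linear[of "A q"] wc, of y0]) (rule that)
  have "continuous_on {T..T + h} (\<lambda>r. A q *v y r + B q *v v r)"
    by (intro continuous_on_add linear_continuous_on_compose[OF yc matrix_vector_mul_linear]
        continuous_on_subset[OF wc]) auto
  then have "bounded ((\<lambda>r. A q *v y r + B q *v v r) ` {T..T + h})"
    by (intro compact_imp_bounded compact_continuous_image) auto
  then obtain C where C: "C > 0" "\<And>r. r \<in> {T..T + h} \<Longrightarrow> norm (A q *v y r + B q *v v r) \<le> C"
    by (auto simp: bounded_pos)
  \<comment> \<open>Only the continuous state moves, and its velocity is bounded by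
    \<open>C\<close>.\<close>
  have ylip: "C-lipschitz_on {T..T + h} (\<lambda>r. (y r, p, z))"
  proof (rule lipschitz_onI)
    fix r r' assume rr: "r \<in> {T..T + h}" "r' \<in> {T..T + h}"
    have "norm (y r - y r') \<le> C * norm (r - r')"
    proof (rule differentiable_bound[of "{T..T + h}" y "\<lambda>r x. x *\<^sub>R (A q *v y r + B q *v v r)"])
      show "(y has_derivative (\<lambda>x. x *\<^sub>R (A q *v y r + B q *v v r))) (at r within {T..T + h})"
        if "r \<in> {T..T + h}" for r using bspec[OF yd that] by (simp add: has_vector_derivative_def)
      show "onorm (\<lambda>x. x *\<^sub>R (A q *v y r + B q *v v r)) \<le> C" if "r \<in> {T..T + h}" for r
      proof (rule onorm_le)
        fix x :: real
        show "norm (x *\<^sub>R (A q *v y r + B q *v v r)) \<le> C * norm x"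
          using mult_right_mono[OF C(2)[OF that], of "\<bar>x\<bar>"] by (simp add: mult.commute)
      qed
    qed (use rr in auto)
    then show "dist (y r, p, z) (y r', p, z) \<le> C * dist r r'"
      by (simp add: dist_Pair_Pair dist_norm)
  qed (use C in simp)
  have xlip: "M-lipschitz_on {t J..T} (\<lambda>s. \<xi> s J)"
    unfolding M_def
  proof (rule flow_lipschitz[OF sol v Y])
    have "(s, J) \<in> E" if "t J \<le> s" "s \<le> T" for s
      using dom(7)[OF that(1)] TE that(2) by (cases "s = T") auto
    then show "{t J..T} \<times> {J} \<subseteq> E" by auto
  qed auto
  define g where "g s = (if s \<le> T then \<xi> s J else (y s, p, z))" for s
  have glip: "(max M C)-lipschitz_on {t J..T + h} g"
    unfolding g_def by (rule lipschitz_on_concat_max[OF xlip ylip]) (simp add: xT yT)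
  have zH: "(y s, p, z) \<in> flow_set H" for s
    unfolding mem_switched_flow_set using q z by auto
  show False
  proof (rule no_extension[of "T + h" g, OF _ _ _ glip])
    show "T \<le> T + h" "(T + h, J) \<notin> E" using h dom(6)[of "T + h"] by auto
    show "g s = \<xi> s J" if "(s, J) \<in> E" for s using dom(6)[OF that] by (simp add: g_def)
    show "g s \<in> flow_set H" if s: "s \<in> {t J<..<T + h}" for s
    proof (cases s T rule: linorder_cases)
      case less
      then show ?thesis using N(2) s by (simp add: g_def)
    next
      case equal
      then show ?thesis using zH[of T] by (simp add: g_def xT yT)
    next
      case greater
      then show ?thesis using zH by (simp add: g_def)
    qed
    \<comment> \<open>The velocities on the two sides of the joint may differ, so \<open>T\<close>
      joins the null set.\<close>
    show "negligible (insert T N)" using N(1) by simp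
    show "\<exists>w\<in>flow_map H (g s) (v s). (g has_vector_derivative w) (at s)"
      if s: "s \<in> {t J<..<T + h} - insert T N" for s
    proof (cases "s < T")
      case True
      then have "s \<in> {t J<..<T} - N" using s by auto
      then obtain d where d: "d \<in> flow_map H (\<xi> s J) (v s)" "((\<lambda>r. \<xi> r J) has_vector_derivative d) (at s)"
        using N(3) by blast
      have "(g has_vector_derivative d) (at s)"
        by (rule has_vector_derivative_transform_within_open[OF d(2), of "{..<T}"]) (use True in \<open>auto simp: g_def\<close>)
      then show ?thesis using d(1) True by (auto simp: g_def)
    next
      case False
      then have sT: "s \<in> {T<..<T + h}" using s by auto
      let ?d = "A q *v y s + B q *v v s"
      have "at s within {T..T + h} = at s" by (rule at_within_Icc_at) (use sT in auto)
      then have "(y has_vector_derivative ?d) (at s)" using bspec[OF yd, of s] sT by auto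
      then have "((\<lambda>r. (y r, p, z)) has_vector_derivative (?d, 0, 0)) (at s)"
        by (intro has_vector_derivative_Pair has_vector_derivative_const)
      then have "(g has_vector_derivative (?d, 0, 0)) (at s)"
        by (rule has_vector_derivative_transform_within_open[of _ _ _ "{T<..}"]) (use sT in \<open>auto simp: g_def\<close>)
      moreover have "(?d, 0, 0) \<in> flow_map H (g s) (v s)"
        using sT q eta by (auto simp: g_def switched_system_def)
      ultimately show ?thesis by blast
    qed
  qed
qed

end

section \<open>Constants common to all modes and the final estimate\<close>

lemma finite_common_bound:
  fixes f :: "'i \<Rightarrow> real"
  assumes "finite S"
  obtains M where "M \<ge> 1" "\<And>q. q \<in> S \<Longrightarrow> f q \<le> M"
proof
  show "1 \<le> Max (insert 1 (f ` S))" using assms by (intro Max_ge) auto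
  show "f q \<le> Max (insert 1 (f ` S))" if "q \<in> S" for q using assms that by (intro Max_ge) auto
qed

lemma matrix_common_bound:
  fixes A :: "'i \<Rightarrow> real^'m^'n"
  assumes "finite S"
  obtains M where "M \<ge> 0" "\<And>q x. q \<in> S \<Longrightarrow> norm (A q *v x) \<le> M * norm x"
proof -
  obtain M where M: "M \<ge> 1" "\<And>q. q \<in> S \<Longrightarrow> onorm ((*v) (A q)) \<le> M"
    using finite_common_bound[OF assms, of "\<lambda>q. onorm ((*v) (A q))"] by blast
  have "norm (A q *v x) \<le> M * norm x" if "q \<in> S" for q x
    using onorm[OF matrix_vector_mul_bounded_linear, of "A q" x] M(2)[OF that]
    by (meson mult_right_mono norm_ge_zero order_trans)
  with M(1) show ?thesis by (intro that[of M]) auto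
qed

text \<open>With finitely many modes the smallest rate and the largest bound serve all of them;
  lowering a rate is harmless because the forms are nonnegative.\<close>

lemma hurwitz_common_quadratic_forms:
  fixes A :: "'i \<Rightarrow> real^'n^'n"
  assumes fin: "finite S" and hur: "\<And>q. q \<in> S \<Longrightarrow> hurwitz (A q)"
  obtains P a K where "a > 0" "K \<ge> 1" "\<And>q. q \<in> S \<Longrightarrow> bounded_bilinear (P q)"
    "\<And>q x y. q \<in> S \<Longrightarrow> P q x y = P q y x"
    "\<And>q x. q \<in> S \<Longrightarrow> (norm x)\<^sup>2 \<le> P q x x"
    "\<And>q x y. q \<in> S \<Longrightarrow> \<bar>P q x y\<bar> \<le> K * norm x * norm y"
    "\<And>q x. q \<in> S \<Longrightarrow> P q x (A q *v x) \<le> - a * P q x x"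
proof -
  have "\<exists>P a K. a > 0 \<and> bounded_bilinear P \<and> (\<forall>x y. P x y = P y x) \<and> (\<forall>x. (norm x)\<^sup>2 \<le> P x x) \<and>
      (\<forall>x y. \<bar>P x y\<bar> \<le> K * norm x * norm y) \<and> (\<forall>x. P x (A q *v x) \<le> - a * P x x)"
    if q: "q \<in> S" for q
  proof (rule hurwitz_quadratic_form[OF hur[OF q]])
    fix P a
    assume P: "bounded_bilinear P" "\<And>x y. P x y = P y x" "a > 0"
      "\<And>x. (norm x)\<^sup>2 \<le> P x x" "\<And>x. P x (A q *v x) \<le> - a * P x x"
    obtain K where K: "\<And>x y. norm (P x y) \<le> norm x * norm y * K"
      using bounded_bilinear.bounded[OF P(1)] by blast
    have "\<bar>P x y\<bar> \<le> K * norm x * norm y" for x y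
      using K[of x y] by (simp add: mult_ac)
    with P show ?thesis by blast
  qed
  then obtain P a K where P: "\<forall>q\<in>S. a q > 0 \<and> bounded_bilinear (P q) \<and> (\<forall>x y. P q x y = P q y x) \<and>
      (\<forall>x. (norm x)\<^sup>2 \<le> P q x x) \<and> (\<forall>x y. \<bar>P q x y\<bar> \<le> K q * norm x * norm y) \<and>
      (\<forall>x. P q x (A q *v x) \<le> - a q * P q x x)"
    by metis
  obtain K' where K': "K' \<ge> 1" "\<And>q. q \<in> S \<Longrightarrow> K q \<le> K'" using finite_common_bound[OF fin, of K] by blast
  define a' where "a' = Min (insert 1 (a ` S))"
  have a': "a' > 0" unfolding a'_def using fin P by (subst Min_gr_iff) auto
  have aa: "a' \<le> a q" if "q \<in> S" for q unfolding a'_def using fin that by (intro Min_le) auto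
  show ?thesis
  proof (rule that[OF a' K'(1), of P])
    fix q assume q: "q \<in> S"
    then show "bounded_bilinear (P q)" "P q x y = P q y x" "(norm x)\<^sup>2 \<le> P q x x" for x y
      using P by blast+
    show "\<bar>P q x y\<bar> \<le> K' * norm x * norm y" for x y
    proof -
      have "\<bar>P q x y\<bar> \<le> K q * norm x * norm y" using P q by blast
      also have "\<dots> \<le> K' * norm x * norm y" using K'(2)[OF q] by (intro mult_right_mono) auto
      finally show ?thesis .
    qed
    show "P q x (A q *v x) \<le> - a' * P q x x" for x
    proof -
      have "0 \<le> P q x x" using P q order_trans[OF zero_le_power2] by blast
      then have "a' * P q x x \<le> a q * P q x x" by (rule mult_right_mono[OF aa[OF q]])
      moreover have "P q x (A q *v x) \<le> - a q * P q x x" using P q by blast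
      ultimately show ?thesis by simp
    qed
  qed
qed

theorem theorem2:
  fixes l :: nat
    and Dnet Meff :: "nat \<Rightarrow> real"
    and tau K zeta :: "real^'g::finite"
    and tauz psi N0 :: real
    and A :: "nat \<Rightarrow> real^('g state_ix)^('g state_ix)"
    and B :: "nat \<Rightarrow> real^('g input_ix)^('g state_ix)"
    and u :: "nat \<Rightarrow> real^('g input_ix)"
    and b :: "nat \<Rightarrow> real^('g state_ix)"
    and c :: real
  assumes "l \<ge> 2"
    and "N0 \<ge> 1"
    and "\<And>q. q \<in> {1..l} \<Longrightarrow> Meff q > 0"
    and "\<And>g. tau $ g > 0"
    and "\<And>g. 0 \<le> zeta $ g \<and> zeta $ g \<le> 1"
    and "(\<Sum>g\<in>UNIV. zeta $ g) = 1"
    and "\<And>g. tauz > tau $ g"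
    and "psi < 0"
    and "\<And>q. q \<in> {1..l} \<Longrightarrow> A q = system_matrix (Dnet q) (Meff q) tau K zeta tauz psi"
    and "\<And>q. q \<in> {1..l} \<Longrightarrow> B q = input_matrix (Meff q) tau zeta"
    and "\<And>q. q \<in> {1..l} \<Longrightarrow> b q = B q *v u q"
    and "c = (MAX q\<in>{1..l}. MAX r\<in>{1..l} - {q}.
                norm (matrix_inv (A r) *v b r - matrix_inv (A q) *v b q))"
    and "\<And>q. q \<in> {1..l} \<Longrightarrow> hurwitz (A q)"
  shows "\<exists>\<eta>s>0. \<forall>\<eta>. 0 < \<eta> \<and> \<eta> < \<eta>s \<longrightarrow>
    (\<exists>\<kappa>1>0. \<exists>\<kappa>2>0. \<exists>\<kappa>3>0.
      \<forall>v :: real \<Rightarrow> real^('g input_ix).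
        continuous_on {0..} v \<and> bdd_above ((\<lambda>t. norm (v t)) ` {0..}) \<longrightarrow>
        (\<forall>E \<xi>. maximal_hybrid_solution (switched_system l A B b N0 \<eta>) v E \<xi> \<longrightarrow>
          complete_time_domain E \<and>
          (\<forall>(t, j) \<in> E.
            infdist (\<xi> t j) (attractor l N0)
              \<le> \<kappa>1 * exp (- \<kappa>2 * (t + real j)) * infdist (\<xi> 0 0) (attractor l N0)
                + \<kappa>3 * ((SUP t\<in>{0..}. norm (v t)) + c))))"
proof -
  let ?\<delta> = "\<lambda>q r. norm (matrix_inv (A r) *v b r - matrix_inv (A q) *v b q)"
  have jump: "?\<delta> q r \<le> c" if "q \<in> {1..l}" "r \<in> {1..l}" "r \<noteq> q" for q r
  proof -
    have "?\<delta> q r \<le> (MAX r\<in>{1..l} - {q}. ?\<delta> q r)"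
      by (rule Max_ge) (use that in auto)
    also have "\<dots> \<le> c" unfolding assms(12) by (rule Max_ge) (use that in auto)
    finally show ?thesis .
  qed
  \<comment> \<open>Since \<open>l \<ge> 2\<close>, the pair of modes 1 and 2 is available.\<close>
  have c0: "c \<ge> 0" using order_trans[OF norm_ge_zero jump[of 1 2]] assms(1) by simp
  have fin: "finite {1..l}" by simp
  show ?thesis
  proof (rule hurwitz_common_quadratic_forms[of "{1..l}" A, OF fin assms(13)])
    fix P a C
    assume P: "a > 0" "C \<ge> 1" "\<And>q. q \<in> {1..l} \<Longrightarrow> bounded_bilinear (P q)"
      "\<And>q x y. q \<in> {1..l} \<Longrightarrow> P q x y = P q y x"
      "\<And>q x. q \<in> {1..l} \<Longrightarrow> (norm x)\<^sup>2 \<le> P q x x"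
      "\<And>q x y. q \<in> {1..l} \<Longrightarrow> \<bar>P q x y\<bar> \<le> C * norm x * norm y"
      "\<And>q x. q \<in> {1..l} \<Longrightarrow> P q x (A q *v x) \<le> - a * P q x x"
    obtain \<alpha> where \<alpha>: "\<alpha> \<ge> 0" "\<And>q x. q \<in> {1..l} \<Longrightarrow> norm (A q *v x) \<le> \<alpha> * norm x"
      by (rule matrix_common_bound[OF fin, of A]) (rule that; blast)
    obtain \<beta> where \<beta>: "\<beta> \<ge> 0" "\<And>q x. q \<in> {1..l} \<Longrightarrow> norm (B q *v x) \<le> \<beta> * norm x"
      by (rule matrix_common_bound[OF fin, of B]) (rule that; blast)
    have ln: "ln (4 * C) > 0" using P(2) by (intro ln_gt_zero) auto
    show ?thesis
    \<comment> \<open>This threshold is the assumption \<open>dwell\<close> solved for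
      \<open>\<eta>\<close>.\<close>
    proof (rule exI[of _ "a / ln (4 * C)"], intro conjI allI impI)
      show "0 < a / ln (4 * C)" using P(1) ln by simp
      fix \<eta> :: real assume \<eta>: "0 < \<eta> \<and> \<eta> < a / ln (4 * C)"
      interpret switched_lyapunov l A B b N0 \<eta> a C \<alpha> \<beta> c P
      proof (rule switched_lyapunov.intro)
        show "ln (4 * C) * \<eta> < a" using \<eta> ln by (simp add: pos_less_divide_eq mult.commute)
      qed (use P \<alpha> \<beta> c0 jump assms(2) \<eta> in auto)
      \<comment> \<open>The constants are fixed before the input is introduced, as the order of
        quantifiers demands.\<close>
      define G where "G = exp (L * N0) * C"
      define R where "R = exp (L * N0) * (C\<^sup>2 * \<beta>\<^sup>2 / (a * \<kappa>) + 1)"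
      have G: "sqrt G > 0" using P(2) by (simp add: G_def)
      have "C\<^sup>2 * \<beta>\<^sup>2 / (a * \<kappa>) \<ge> 0" using P(1) kappa(1) by simp
      then have R: "sqrt R > 0" by (simp add: R_def add_nonneg_pos)
      show "\<exists>\<kappa>1>0. \<exists>\<kappa>2>0. \<exists>\<kappa>3>0.
        \<forall>v :: real \<Rightarrow> real^('g input_ix).
          continuous_on {0..} v \<and> bdd_above ((\<lambda>t. norm (v t)) ` {0..}) \<longrightarrow>
          (\<forall>E \<xi>. maximal_hybrid_solution H v E \<xi> \<longrightarrow>
            complete_time_domain E \<and>
            (\<forall>(t, j) \<in> E.
              infdist (\<xi> t j) (attractor l N0)
                \<le> \<kappa>1 * exp (- \<kappa>2 * (t + real j)) * infdist (\<xi> 0 0) (attractor l N0)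
                  + \<kappa>3 * ((SUP t\<in>{0..}. norm (v t)) + c)))"
      proof (rule exI[of _ "sqrt G"], intro conjI G, rule exI[of _ "\<kappa> / 2"], intro conjI,
          use kappa(1) in simp, rule exI[of _ "sqrt R"], intro conjI R allI impI)
        fix v :: "real \<Rightarrow> real^('g input_ix)" and E \<xi>
        assume v: "continuous_on {0..} v \<and> bdd_above ((\<lambda>t. norm (v t)) ` {0..})"
          and max: "maximal_hybrid_solution H v E \<xi>"
        let ?U = "SUP t\<in>{0..}. norm (v t)"
        have U: "norm (v t) \<le> ?U" if "t \<ge> 0" for t
          using v that by (intro cSUP_upper) auto
        have sol: "hybrid_solution H v E \<xi>" using max by (simp add: maximal_hybrid_solution_def)
        show "complete_time_domain E" using maximal_solution_complete[OF max U] v by blast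
        have "infdist (\<xi> t j) (attractor l N0)
                \<le> sqrt G * exp (- (\<kappa> / 2) * (t + real j)) * infdist (\<xi> 0 0) (attractor l N0)
                  + sqrt R * (?U + c)" if tj: "(t, j) \<in> E" for t j
          using norm_bound[OF sol U tj] switched_init[OF sol] switched_solution_in_flow_set[OF sol tj]
          unfolding G_def R_def by (simp only: infdist_attractor)
        then show "\<forall>(t, j) \<in> E.
              infdist (\<xi> t j) (attractor l N0)
                \<le> sqrt G * exp (- (\<kappa> / 2) * (t + real j)) * infdist (\<xi> 0 0) (attractor l N0)
                  + sqrt R * (?U + c)"
          by blast
      qed
    qed
  qed
qed

end
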